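(* Let $R>1$ and let $f=\{f_v:\ v\in B(s,R)\}$ be a family of holomorphic functions on the open unit disk $\mathbb{D}_1\subset\mathbb{C}$ depending holomorphically on the parameter $v\in B(s,R)\subset\mathbb{C}^s$. Define $f_0(v):=f_v(0)$, a holomorphic function on $B(s,R)$, and let $d_{f_0}(R)$ be its Chebyshev degree in $B(s,1)$. Let $V\subset B(s,1)\subset\mathbb{C}^s(\cong\mathbb{R}^{2s})$ be a convex set of real dimension $k$. Assume that $$\sup_{v\in V}\sup_{z\in\mathbb{D}_1}|f_v(z)|\le M_1<\infty\qquad\text{and}\qquad \sup_{v\in V}|f_0(v)|\ge M_2>0 .$$ Then for $0<\rho<1$ and every $T\ge 0$, $$|\{v\in V:\ \mathcal{N}_{f,\rho}(v)\ge T\}|\le 4k\left(\frac{M_1}{M_2}\right)^{1/d_{f_0}(R)}\cdot e^{-[\log(1/\rho)/d_{f_0}(R)]\,T}\cdot|V| .$$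
   Context: $B(s,R)$ is the open Euclidean ball of radius $R$ in $\mathbb{C}^s$ centered at $0$, and $\mathbb{D}_t=B(1,t)\subset\mathbb{C}$. That the family depends holomorphically on $v$ means that $(v,z)\mapsto f_v(z)$ is holomorphic on $B(s,R)\times\mathbb{D}_1$. Zero-counting function: $\mathcal{N}_{f,\rho}(v):=\#\{z\in\overline{\mathbb{D}}_\rho:\ f_v(z)=0\}$, with $\mathcal{N}_{f,\rho}(v)=+\infty$ if $f_v\equiv 0$ on $\mathbb{D}_1$. Chebyshev degree: for $R>1$ and a holomorphic function $h$ on $B(s,R)$, the Chebyshev degree $d_h(R)$ of $h$ in $B(s,1)$ is the optimal (smallest) constant $d$ such that for every real interval (straight line segment) $I\subset B(s,1)$, where $\mathbb{C}^s$ is identified with $\mathbb{R}^{2s}$, and every measurable subset $\omega\subset I$ (of positive length), $$\sup_I|h|\le\left(\frac{4|I|}{|\omega|}\right)^{d}\sup_\omega|h| ,$$ where $|\cdot|$ of a subset of $I$ is its one-dimensional Lebesgue measure. It is known that such a finite constant $d>0$ exists. The real dimension of $V$ is the dimension of its real affine hull, and for $E\subset V$ (including $E=V$), $|E|$ denotes Lebesgue measure in the real affine hull of $V$. *)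

theory Defs
  imports "HOL-Analysis.Analysis"
begin

text \<open>
  Joint holomorphy of \<open>(v, z) \<mapsto> f v z\<close> on \<open>U \<times> D\<close>, a subset of the product of
  complex s-space with the complex plane (both factors are meant to be open): at every
  point the map has a total derivative and this derivative is complex linear.
\<close>
definition holomorphic_family ::
    "(complex^'s \<Rightarrow> complex \<Rightarrow> complex) \<Rightarrow> (complex^'s) set \<Rightarrow> complex set \<Rightarrow> bool" where
  "holomorphic_family f U D \<longleftrightarrow>
     (\<forall>v\<in>U. \<forall>z\<in>D. \<exists>F. ((\<lambda>(v, z). f v z) has_derivative F) (at (v, z)) \<and>
        (\<forall>c w y. F (c *s w, c * y) = c * F (w, y)))"

text \<open>Distinct zeros are counted, without multiplicity.\<close>
definition zero_count ::
    "('v \<Rightarrow> complex \<Rightarrow> complex) \<Rightarrow> real \<Rightarrow> 'v \<Rightarrow> ereal" where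
  "zero_count f \<rho> v =
     (if \<forall>z\<in>ball 0 1. f v z = 0 then \<infinity>
      else ereal (real (card {z \<in> cball 0 \<rho>. f v z = 0})))"

text \<open>
  Lebesgue measure on an affine subspace \<open>A\<close>, as a measure on the ambient space that is
  concentrated on \<open>A\<close>. It is built like \<open>lborel\<close>, with the standard basis replaced by
  an orthonormal basis \<open>B\<close> of the direction space of \<open>A\<close>; by the invariance of Lebesgue
  measure under isometries the choice of \<open>a\<close> and \<open>B\<close> does not matter.
\<close>
definition affine_lborel :: "'a::euclidean_space set \<Rightarrow> 'a measure" where
  "affine_lborel A =
     (let a = SOME a. a \<in> A;
          B = SOME B. pairwise orthogonal B \<and> (\<forall>b\<in>B. norm b = 1) \<and>
                      span B = span ((\<lambda>x. x - a) ` A)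
      in distr (\<Pi>\<^sub>M b\<in>B. lborel) borel (\<lambda>g. a + (\<Sum>b\<in>B. g b *\<^sub>R b)))"

definition hull_lebesgue :: "'a::euclidean_space set \<Rightarrow> 'a measure" where
  "hull_lebesgue S = completion (affine_lborel (affine hull S))"

text \<open>
  Intervals may be open, half-open or closed, but not reduced to a point: they are the
  convex sets whose affine hull is a line.
\<close>
definition chebyshev_constant :: "(complex^'s \<Rightarrow> complex) \<Rightarrow> real \<Rightarrow> bool" where
  "chebyshev_constant h d \<longleftrightarrow>
     (\<forall>I \<omega>. convex I \<longrightarrow> aff_dim I = 1 \<longrightarrow> I \<subseteq> ball 0 1 \<longrightarrow>
        \<omega> \<subseteq> I \<longrightarrow> \<omega> \<in> sets (hull_lebesgue I) \<longrightarrow> measure (hull_lebesgue I) \<omega> > 0 \<longrightarrow>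
        (SUP v\<in>I. ereal (norm (h v)))
          \<le> ereal ((4 * measure (hull_lebesgue I) I / measure (hull_lebesgue I) \<omega>) powr d)
             * (SUP v\<in>\<omega>. ereal (norm (h v))))"

text \<open>
  The radius \<open>R\<close> of the ball on which \<open>h\<close> is holomorphic does not enter the inequalities:
  all intervals lie in the unit ball. Only nonnegative constants are considered; if \<open>h\<close> is not
  identically zero on the unit ball, no negative constant is admissible (take \<open>\<omega> = I\<close>).
  The infimum is \<open>\<infinity>\<close> if there is no finite constant, which is known not to happen for
  \<open>h\<close> holomorphic on a ball of radius greater than 1. The infimum is 0 if \<open>h\<close> is constant.
\<close>
definition chebyshev_degree :: "(complex^'s \<Rightarrow> complex) \<Rightarrow> ereal" where
  "chebyshev_degree h = Inf {ereal d |d. 0 \<le> d \<and> chebyshev_constant h d}"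

end

theory Submission
  imports Defs "HOL-Complex_Analysis.Complex_Analysis"
begin

text \<open>
  Dividing \<open>f v\<close> by the Blaschke factors of its zeros in the disc of radius \<open>\<rho>\<close> shows that
  \<open>T\<close> zeros force \<open>|f v 0| \<le> M1 * \<rho> powr T\<close>, so the set in question lies in a sublevel set of
  \<open>v \<mapsto> f v 0\<close>. Fix \<open>v0\<close> in the relative interior of \<open>V\<close> where \<open>|f v0 0|\<close> is almost \<open>M2\<close>. The
  Chebyshev inequality on each ray from \<open>v0\<close> bounds the proportion of the ray that the sublevel
  set occupies, and integrating over all rays costs a factor \<open>k\<close>. Every \<open>\<delta> > 0\<close> above the
  Chebyshev degree can play the role of the degree here, and one passes to the limit in \<open>\<delta>\<close>.
\<close>

section \<open>Zeros in a disc\<close>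

text \<open>The constant \<open>4 * k\<close> has two sources. The 4 is the one in the Chebyshev
  inequality. The factor \<open>k\<close> comes from comparing length with volume: along a ray from
  \<open>v0\<close>, volume has density proportional to \<open>s ^ (k - 1)\<close>, so a part of
  relative length c at the far end of every ray has relative volume 1 - (1 - c)^k \<le> k c.

  The relative interior enters for measurability as well as for geometry. A convex set may contain
  an arbitrary part of its relative boundary and need not be Borel, while exchanging integrals
  requires Borel sets. All integration therefore takes place on the relative interior, which is
  Borel and star-shaped about each of its points; the relative boundary is null, and
  \<open>V\<close> itself is measurable only for the completion.

  The degree is an infimum that may be 0, whereas bounding the length of a sublevel set means taking
  a root of the Chebyshev inequality. A positive exponent \<delta> strictly above the degree
  provides both an admissible constant below it and a meaningful power
  \<open>1 / \<delta>\<close>.\<close>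

lemma norm_le_Moebius_function:
  assumes f: "f holomorphic_on ball 0 1" and M: "\<And>z. z \<in> ball 0 1 \<Longrightarrow> norm (f z) \<le> M"
    and a: "a \<in> ball 0 1" "f a = 0" and z: "z \<in> ball 0 1"
  shows "norm (f z) \<le> M * norm (Moebius_function 0 a z)"
proof -
  have M0: "M \<ge> 0"
    using M[OF z] norm_ge_zero order_trans by blast
  have na: "norm (-a) < 1" and nz: "norm z < 1"
    using a z by simp_all
  define w where "w = Moebius_function 0 a z"
  have w: "norm w < 1"
    unfolding w_def using a nz by (intro Moebius_function_norm_lt_1) auto
  have zw: "Moebius_function 0 (-a) w = z"
    unfolding w_def using na nz by (intro Moebius_function_compose) auto
  have "norm (f z) \<le> (M + e) * norm w" if e: "e > 0" for e
  proof -
    \<comment> \<open>Schwarz's lemma is applied to \<open>f\<close> precomposed with the disc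
      automorphism that takes 0 to \<open>a\<close>. The slack \<open>e\<close> gives the strict
      bound 1 that it asks for, and a nonzero divisor even when \<open>M = 0\<close>.\<close>
    let ?g = "\<lambda>y. f (Moebius_function 0 (-a) y) / of_real (M + e)"
    have "f \<circ> Moebius_function 0 (-a) holomorphic_on ball 0 1"
      by (rule holomorphic_on_compose_gen[OF Moebius_function_holomorphic[OF na] f])
        (auto intro: Moebius_function_norm_lt_1[OF na])
    then have "?g holomorphic_on ball 0 1"
      using e M0 by (intro holomorphic_on_divide) (auto simp: o_def simp flip: of_real_add)
    moreover have "?g 0 = 0"
      using a by (simp add: Moebius_function_of_zero)
    moreover have "norm (?g y) < 1" if "norm y < 1" for y
    proof -
      have "norm (f (Moebius_function 0 (-a) y)) \<le> M"
        using Moebius_function_norm_lt_1[OF na that] by (intro M) auto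
      then show ?thesis
        using e M0 by (simp add: norm_divide divide_simps del: of_real_add)
    qed
    ultimately have "norm (?g w) \<le> norm w"
      using w by (rule Schwarz_Lemma)
    then show ?thesis
      using e M0 by (simp add: zw norm_divide divide_simps mult.commute del: of_real_add)
  qed
  moreover have "(M + e) * norm w \<le> M * norm w + e" if "e > 0" for e
    using w that by (simp add: distrib_right mult_left_le)
  ultimately have "norm (f z) \<le> M * norm w + e" if "e > 0" for e
    using that by (meson order_trans)
  then show ?thesis
    unfolding w_def by (rule field_le_epsilon)
qed

text \<open>The zero at \<open>a\<close> makes the singularity of the quotient removable, and the
  preceding estimate contains the factor \<open>norm (Moebius_function 0 a z)\<close>, so dividing
  by it does not worsen the bound \<open>M\<close>.\<close>

lemma divide_Moebius_function:
  assumes f: "f holomorphic_on ball 0 1" and M: "\<And>z. z \<in> ball 0 1 \<Longrightarrow> norm (f z) \<le> M"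
    and a: "a \<in> ball 0 1" "f a = 0"
  obtains g where "g holomorphic_on ball 0 1" "\<And>z. z \<in> ball 0 1 \<Longrightarrow> norm (g z) \<le> M"
    "\<And>z. z \<in> ball 0 1 \<Longrightarrow> f z = Moebius_function 0 a z * g z"
proof -
  have nz: "1 - cnj a * z \<noteq> 0" if "z \<in> ball 0 1" for z
  proof
    assume "1 - cnj a * z = 0"
    then have "norm (cnj a * z) = 1"
      by (metis eq_iff_diff_eq_0 norm_one)
    moreover have "norm (cnj a * z) < 1"
      using norm_mult_less[of "cnj a" 1 z 1] a that by simp
    ultimately show False by simp
  qed
  define q where "q = (\<lambda>z. if z = a then deriv f a else f z / (z - a))"
  have "q holomorphic_on ball 0 1"
    by (rule pole_theorem_0[OF f, of a]) (use a in \<open>auto simp: q_def interior_open\<close>)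
  define g where "g z = q z * (1 - cnj a * z)" for z
  have g: "g holomorphic_on ball 0 1"
    unfolding g_def by (intro holomorphic_intros \<open>q holomorphic_on ball 0 1\<close>)
  have eq: "f z = Moebius_function 0 a z * g z" if "z \<in> ball 0 1" for z
    using nz[OF that] a by (auto simp: Moebius_function_simple g_def q_def)
  have bd: "norm (g z) \<le> M" if z: "z \<in> ball 0 1" "z \<noteq> a" for z
  proof -
    have "norm (Moebius_function 0 a z) > 0"
      using nz[OF z(1)] z(2) by (simp add: Moebius_function_simple)
    moreover have "norm (Moebius_function 0 a z) * norm (g z) \<le> norm (Moebius_function 0 a z) * M"
      using norm_le_Moebius_function[OF f M a z(1)] eq[OF z(1)] by (simp add: norm_mult mult.commute)
    ultimately show ?thesis by simp
  qed
  \<comment> \<open>At \<open>a\<close> the Moebius factor vanishes and cannot be cancelled; the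
    bound there is the limit of the bounds at nearby points.\<close>
  have "norm (g a) \<le> M"
  proof (rule tendsto_upperbound)
    have "isCont g a"
      using holomorphic_on_imp_continuous_on[OF g] a by (simp add: continuous_on_eq_continuous_at[OF open_ball])
    then show "((\<lambda>z. norm (g z)) \<longlongrightarrow> norm (g a)) (at a)"
      by (intro tendsto_norm) (simp add: isCont_def)
    have "eventually (\<lambda>z. z \<in> ball 0 1) (at a)"
      using a by (intro eventually_at_in_open') auto
    then show "eventually (\<lambda>z. norm (g z) \<le> M) (at a)"
      using eventually_neq_at_within[of a a UNIV] by eventually_elim (use bd in auto)
  qed auto
  then have "norm (g z) \<le> M" if "z \<in> ball 0 1" for z
    using bd[OF that] by (cases "z = a") auto
  then show thesis
    by (rule that[OF g _ eq])
qed

text \<open>Each division by a Moebius factor gains its modulus at 0, which is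
  \<open>norm a \<le> \<rho>\<close>. The factor vanishes only at \<open>a\<close>, so the other
  points of \<open>Z\<close> remain zeros of the quotient and the induction continues with the same
  \<open>M\<close>.\<close>

lemma norm_at_0_le_power_card_zeros:
  assumes "finite Z" "Z \<subseteq> cball 0 \<rho>" "\<rho> < 1"
    and "f holomorphic_on ball 0 1" "\<And>z. z \<in> ball 0 1 \<Longrightarrow> norm (f z) \<le> M"
    and "\<And>z. z \<in> Z \<Longrightarrow> f z = 0"
  shows "norm (f 0) \<le> M * \<rho> ^ card Z"
  using assms
proof (induction Z arbitrary: f rule: finite_induct)
  case empty
  then show ?case by simp
next
  case (insert a Z)
  have a: "a \<in> ball 0 1" "f a = 0" "norm a \<le> \<rho>"
    using insert.prems by auto
  obtain g where g: "g holomorphic_on ball 0 1" "\<And>z. z \<in> ball 0 1 \<Longrightarrow> norm (g z) \<le> M"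
    "\<And>z. z \<in> ball 0 1 \<Longrightarrow> f z = Moebius_function 0 a z * g z"
    using divide_Moebius_function[OF insert.prems(3,4) a(1,2)] by blast
  have "g z = 0" if z: "z \<in> Z" for z
  proof -
    have z1: "norm z < 1" "z \<noteq> a"
      using z insert by (auto simp: subset_iff)
    have "Moebius_function 0 a z \<noteq> 0"
    proof
      assume "Moebius_function 0 a z = 0"
      then have "Moebius_function 0 (-a) 0 = z"
        using Moebius_function_compose[of "-a" a z] a z1 by simp
      then show False
        using z1 by (simp add: Moebius_function_of_zero)
    qed
    then show ?thesis
      using g(3)[of z] z1 insert.prems(5)[of z] z by auto
  qed
  then have "norm (g 0) \<le> M * \<rho> ^ card Z"
    using insert.prems g by (intro insert.IH) auto
  have "norm (f 0) = norm a * norm (g 0)"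
    using g(3)[of 0] by (simp add: Moebius_function_of_zero norm_mult)
  also have "\<dots> \<le> \<rho> * (M * \<rho> ^ card Z)"
    using a(3) \<open>norm (g 0) \<le> M * \<rho> ^ card Z\<close> order_trans[OF norm_ge_zero a(3)]
    by (intro mult_mono) auto
  finally show ?case
    using insert.hyps by (simp add: mult.left_commute)
qed

lemma norm_at_0_le_powr_zero_count:
  assumes f: "f v holomorphic_on ball 0 1" and M: "\<And>z. z \<in> ball 0 1 \<Longrightarrow> norm (f v z) \<le> M"
    and \<rho>: "0 < \<rho>" "\<rho> < 1" and T: "0 \<le> T" "ereal T \<le> zero_count f \<rho> v"
  shows "norm (f v 0) \<le> M * \<rho> powr T"
proof -
  have M0: "M \<ge> 0"
    using order_trans[OF norm_ge_zero M[of 0]] by simp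
  let ?Z = "{z \<in> cball 0 \<rho>. f v z = 0}"
  show ?thesis
  proof (cases "\<forall>z\<in>ball 0 1. f v z = 0")
    case True
    then have "f v 0 = 0" by simp
    then show ?thesis using M0 by simp
  next
    case False
    have card: "T \<le> real (card ?Z)"
      using T(2) unfolding zero_count_def if_not_P[OF False] ereal_less_eq .
    show ?thesis
    proof (cases "finite ?Z")
      case True
      have "norm (f v 0) \<le> M * \<rho> ^ card ?Z"
        using norm_at_0_le_power_card_zeros[OF True _ \<rho>(2) f M] by blast
      also have "\<rho> ^ card ?Z = \<rho> powr real (card ?Z)"
        using \<rho> by (simp add: powr_realpow)
      also have "M * \<rho> powr real (card ?Z) \<le> M * \<rho> powr T"
        using M0 \<rho> card by (intro mult_left_mono powr_mono') auto
      finally show ?thesis .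
    next
      case False
      \<comment> \<open>\<open>card\<close> of an infinite set is 0 by convention, so this case
        leaves only \<open>T = 0\<close>, where the claim is the bound \<open>M\<close> at the
        origin.\<close>
      then have "card ?Z = 0"
        by (rule card.infinite)
      then have "T = 0"
        using card T(1) by linarith
      then show ?thesis
        using M[of 0] \<rho> by simp
    qed
  qed
qed

section \<open>Lebesgue measure on linear and affine subspaces\<close>

definition orthonormal_set :: "'a::real_inner set \<Rightarrow> bool" where
  "orthonormal_set B \<longleftrightarrow> pairwise orthogonal B \<and> (\<forall>b\<in>B. norm b = 1)"

lemma orthonormal_set_independent:
  assumes "orthonormal_set B"
  shows "independent (B :: 'a::euclidean_space set)" "finite B"
proof -
  have "0 \<notin> B"
    using assms by (auto simp: orthonormal_set_def)
  then show "independent B"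
    using assms pairwise_orthogonal_independent[of B] by (auto simp: orthonormal_set_def)
  then show "finite B"
    by (rule independent_imp_finite)
qed

lemma orthonormal_set_inner:
  assumes "orthonormal_set B" "b \<in> B" "b' \<in> B"
  shows "b \<bullet> b' = (if b = b' then 1 else 0)"
  using assms by (auto simp: orthonormal_set_def pairwise_def orthogonal_def norm_eq_1)

lemma inner_orthonormal_sum:
  assumes "orthonormal_set (B :: 'a::euclidean_space set)" "b \<in> B"
  shows "(\<Sum>c\<in>B. g c *\<^sub>R c) \<bullet> b = g b"
proof -
  have "(\<Sum>c\<in>B. g c *\<^sub>R c) \<bullet> b = (\<Sum>c\<in>B. if c = b then g c else 0)"
    unfolding inner_sum_left using assms
    by (intro sum.cong) (auto simp: orthonormal_set_inner)
  then show ?thesis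
    using orthonormal_set_independent[OF assms(1)] assms(2) by simp
qed

text \<open>Boxes determine the product measure, and on a box the claim is the one-dimensional
  affine substitution in each coordinate, with one factor \<open>s\<close> for each.\<close>

lemma nn_integral_PiM_lborel_affine:
  fixes t :: "'i \<Rightarrow> real"
  assumes fin: "finite I" and s: "s > 0"
    and F: "F \<in> borel_measurable (\<Pi>\<^sub>M i\<in>I. (lborel :: real measure))"
  shows "(\<integral>\<^sup>+g. F g \<partial>(\<Pi>\<^sub>M i\<in>I. lborel)) =
    ennreal (s ^ card I) * (\<integral>\<^sup>+g. F (\<lambda>i\<in>I. t i + s * g i) \<partial>(\<Pi>\<^sub>M i\<in>I. lborel))"
proof -
  interpret product_sigma_finite "\<lambda>i::'i. lborel :: real measure" by standard
  let ?P = "\<Pi>\<^sub>M i\<in>I. (lborel :: real measure)"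
  let ?T = "\<lambda>g. \<lambda>i\<in>I. t i + s * g i"
  have T[measurable]: "?T \<in> ?P \<rightarrow>\<^sub>M ?P" 
    by measurable
  have "density (distr ?P ?P ?T) (\<lambda>_. ennreal (s ^ card I)) = ?P"
  proof (rule PiM_eqI[OF fin])
    fix A :: "'i \<Rightarrow> real set" assume A: "\<And>i. i \<in> I \<Longrightarrow> A i \<in> sets lborel"
    then have Am: "PiE I A \<in> sets ?P"
      using fin by (intro sets_PiM_I_finite) auto
    let ?A = "\<lambda>i. {x. t i + s * x \<in> A i}"
    have A'[measurable]: "?A i \<in> sets lborel" if "i \<in> I" for i
    proof -
      have [measurable]: "A i \<in> sets borel" using A[OF that] by simp
      show ?thesis by simp
    qed
    have one: "emeasure lborel (A i) = ennreal s * emeasure lborel (?A i)" if "i \<in> I" for i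
    proof -
      have [measurable]: "A i \<in> sets borel" using A[OF that] by simp
      have "emeasure lborel (A i) = (\<integral>\<^sup>+x. indicator (A i) x \<partial>lborel)"
        by simp
      also have "\<dots> = ennreal \<bar>s\<bar> * (\<integral>\<^sup>+x. indicator (A i) (t i + s * x) \<partial>lborel)"
        using s by (intro nn_integral_real_affine) auto
      also have "(\<integral>\<^sup>+x. indicator (A i) (t i + s * x) \<partial>lborel)
          = (\<integral>\<^sup>+x. indicator (?A i) x \<partial>lborel)"
        by (intro nn_integral_cong) (auto simp: indicator_def)
      finally show ?thesis using s A'[OF that] by simp
    qed
    have "emeasure (density (distr ?P ?P ?T) (\<lambda>_. ennreal (s ^ card I))) (PiE I A)
        = ennreal (s ^ card I) * emeasure (distr ?P ?P ?T) (PiE I A)"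
      using Am by (subst emeasure_density_const) auto
    also have "emeasure (distr ?P ?P ?T) (PiE I A) = emeasure ?P (?T -` PiE I A \<inter> space ?P)"
      using Am by (intro emeasure_distr) auto
    also have "?T -` PiE I A \<inter> space ?P = PiE I ?A"
      by (auto simp: space_PiM PiE_iff)
    also have "emeasure ?P (PiE I ?A) = (\<Prod>i\<in>I. emeasure lborel (?A i))"
      by (intro emeasure_PiM fin A')
    also have "ennreal (s ^ card I) * \<dots> = (\<Prod>i\<in>I. ennreal s * emeasure lborel (?A i))"
      using s by (simp add: prod.distrib ennreal_power)
    also have "\<dots> = (\<Prod>i\<in>I. emeasure lborel (A i))"
      by (intro prod.cong one[symmetric]) auto
    finally show "emeasure (density (distr ?P ?P ?T) (\<lambda>_. ennreal (s ^ card I))) (PiE I A)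
      = (\<Prod>i\<in>I. emeasure lborel (A i))" .
  qed simp
  then have "(\<integral>\<^sup>+g. F g \<partial>?P) = (\<integral>\<^sup>+g. F g \<partial>density (distr ?P ?P ?T) (\<lambda>_. ennreal (s ^ card I)))"
    by simp
  also have "\<dots> = ennreal (s ^ card I) * (\<integral>\<^sup>+g. F (?T g) \<partial>?P)"
    using F by (simp add: nn_integral_density nn_integral_distr nn_integral_cmult)
  finally show ?thesis .
qed

text \<open>This is the construction of \<open>affine_lborel\<close> without the base point: for
  orthonormal \<open>B\<close>, Lebesgue measure on \<open>span B\<close>, carried by the ambient
  Borel sigma-algebra.\<close>

definition span_lborel :: "'a::euclidean_space set \<Rightarrow> 'a measure" where
  "span_lborel B = distr (\<Pi>\<^sub>M b\<in>B. lborel) borel (\<lambda>g. \<Sum>b\<in>B. g b *\<^sub>R b)"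

lemma sets_span_lborel [simp, measurable_cong]: "sets (span_lborel B) = sets borel"
  and space_span_lborel [simp]: "space (span_lborel B) = UNIV"
  by (auto simp: span_lborel_def)

lemma measurable_sum_coordinates [measurable]:
  "(\<lambda>g. \<Sum>b\<in>B. g b *\<^sub>R (b :: 'a::euclidean_space)) \<in> (\<Pi>\<^sub>M b\<in>B. lborel) \<rightarrow>\<^sub>M borel"
  by (intro borel_measurable_sum borel_measurable_scaleR) auto

text \<open>Adding a vector of \<open>span B\<close> shifts each coordinate by a constant, so the
  coordinate formula pushes forward. The case \<open>s = 1\<close> frees the measure from its base
  point; dilations give the homogeneity of degree \<open>card B\<close> behind the integration along
  rays, the null boundary and the null origin.\<close>

lemma nn_integral_span_lborel_affine:
  fixes B :: "'a::euclidean_space set"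
  assumes B: "orthonormal_set B" and s: "s > 0" and t: "t \<in> span B"
    and F[measurable]: "F \<in> borel_measurable borel"
  shows "(\<integral>\<^sup>+x. F x \<partial>span_lborel B) =
    ennreal (s ^ card B) * (\<integral>\<^sup>+x. F (t + s *\<^sub>R x) \<partial>span_lborel B)"
proof -
  note fin = orthonormal_set_independent(2)[OF B]
  obtain u where u: "t = (\<Sum>b\<in>B. u b *\<^sub>R b)"
    using t unfolding span_finite[OF fin] by auto
  have "(\<integral>\<^sup>+x. F x \<partial>span_lborel B) = (\<integral>\<^sup>+g. F (\<Sum>b\<in>B. g b *\<^sub>R b) \<partial>(\<Pi>\<^sub>M b\<in>B. lborel))"
    by (simp add: span_lborel_def nn_integral_distr)
  also have "\<dots> = ennreal (s ^ card B) *
     (\<integral>\<^sup>+g. F (\<Sum>b\<in>B. (\<lambda>i\<in>B. u i + s * g i) b *\<^sub>R b) \<partial>(\<Pi>\<^sub>M b\<in>B. lborel))"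
    by (intro nn_integral_PiM_lborel_affine fin s) measurable
  also have "(\<lambda>g. F (\<Sum>b\<in>B. (\<lambda>i\<in>B. u i + s * g i) b *\<^sub>R b))
      = (\<lambda>g. F (t + s *\<^sub>R (\<Sum>b\<in>B. g b *\<^sub>R b)))"
    by (auto simp: u scaleR_sum_right scaleR_add_left sum.distrib fun_eq_iff cong: sum.cong)
  also have "(\<integral>\<^sup>+g. F (t + s *\<^sub>R (\<Sum>b\<in>B. g b *\<^sub>R b)) \<partial>(\<Pi>\<^sub>M b\<in>B. lborel))
      = (\<integral>\<^sup>+x. F (t + s *\<^sub>R x) \<partial>span_lborel B)"
    unfolding span_lborel_def by (subst nn_integral_distr) auto
  finally show ?thesis .
qed

text \<open>Coordinates in an orthonormal basis are inner products, so by Cauchy-Schwarz the ball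
  pulls back into a box with sides \<open>{-r..r}\<close>.\<close>

lemma emeasure_span_lborel_cball_finite:
  fixes B :: "'a::euclidean_space set"
  assumes B: "orthonormal_set B"
  shows "emeasure (span_lborel B) (cball 0 r) < \<infinity>"
proof -
  interpret product_sigma_finite "\<lambda>i::'a. lborel :: real measure" by standard
  note fin = orthonormal_set_independent(2)[OF B]
  let ?P = "\<Pi>\<^sub>M b\<in>B. (lborel :: real measure)"
  have m: "PiE B (\<lambda>_. {-r..r}) \<in> sets ?P"
    using fin by (intro sets_PiM_I_finite) auto
  have "emeasure (span_lborel B) (cball 0 r)
      = emeasure ?P ((\<lambda>g. \<Sum>b\<in>B. g b *\<^sub>R b) -` cball 0 r \<inter> space ?P)"
    unfolding span_lborel_def by (intro emeasure_distr) auto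
  also have "\<dots> \<le> emeasure ?P (PiE B (\<lambda>_. {-r..r}))"
  proof (intro emeasure_mono m subsetI)
    fix g assume g: "g \<in> (\<lambda>g. \<Sum>b\<in>B. g b *\<^sub>R b) -` cball 0 r \<inter> space ?P"
    have "\<bar>g b\<bar> \<le> r" if b: "b \<in> B" for b
    proof -
      have "\<bar>(\<Sum>c\<in>B. g c *\<^sub>R c) \<bullet> b\<bar> \<le> norm (\<Sum>c\<in>B. g c *\<^sub>R c) * norm b"
        by (rule Cauchy_Schwarz_ineq2)
      also have "\<dots> \<le> r"
        using g b B by (simp add: orthonormal_set_def)
      finally show ?thesis
        using inner_orthonormal_sum[OF B b, of g] by simp
    qed
    then have "-r \<le> g b \<and> g b \<le> r" if "b \<in> B" for b
      using that by (auto simp: abs_le_iff dest!: \<open>\<And>b. b \<in> B \<Longrightarrow> \<bar>g b\<bar> \<le> r\<close>)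
    then show "g \<in> PiE B (\<lambda>_. {-r..r})"
      using g by (auto simp: space_PiM PiE_iff)
  qed
  also have "\<dots> = (\<Prod>b\<in>B. emeasure lborel {-r..r})"
    by (intro emeasure_PiM fin) auto
  also have "\<dots> < \<infinity>"
    by (simp add: power_less_top_ennreal emeasure_lborel_Icc_eq)
  finally show ?thesis .
qed

lemma emeasure_span_lborel_bounded_finite:
  fixes B :: "'a::euclidean_space set"
  assumes B: "orthonormal_set B" and S: "bounded S"
  shows "emeasure (span_lborel B) S < \<infinity>"
proof -
  obtain r where "S \<subseteq> ball 0 r"
    using bounded_subset_ballD[OF S] by blast
  then have "emeasure (span_lborel B) S \<le> emeasure (span_lborel B) (cball 0 r)"
    by (intro emeasure_mono) auto
  then show ?thesis
    using emeasure_span_lborel_cball_finite[OF B, of r] by (rule le_less_trans)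
qed

lemma sigma_finite_span_lborel:
  assumes "orthonormal_set (B :: 'a::euclidean_space set)"
  shows "sigma_finite_measure (span_lborel B)"
proof
  have "(\<Union>n::nat. cball (0::'a) (real n)) = UNIV"
    by (auto intro: real_arch_simple)
  then show "\<exists>A. countable A \<and> A \<subseteq> sets (span_lborel B) \<and> \<Union> A = space (span_lborel B) \<and>
      (\<forall>a\<in>A. emeasure (span_lborel B) a \<noteq> \<infinity>)"
    using emeasure_span_lborel_cball_finite[OF assms]
    by (intro exI[of _ "range (\<lambda>n::nat. cball 0 (real n))"]) (auto simp: less_top)
qed

lemma vimage_translation:
  fixes u :: "'a::ab_group_add"
  shows "(+) u -` X = (+) (-u) ` X"
proof (intro set_eqI iffI)
  fix x assume "x \<in> (+) u -` X"
  then show "x \<in> (+) (-u) ` X"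
    by (intro image_eqI[of _ _ "u + x"]) auto
qed auto

lemma span_diff_eq_affine:
  assumes "affine A" "a \<in> A" "u \<in> A"
  shows "span ((\<lambda>x. x - a) ` A) = span ((\<lambda>x. x - u) ` A)"
proof -
  have *: "(\<lambda>x. x - c) ` A \<subseteq> span ((\<lambda>x. x - c') ` A)" if "c \<in> A" "c' \<in> A" for c c'
  proof
    fix y assume "y \<in> (\<lambda>x. x - c) ` A"
    then obtain x where x: "x \<in> A" "y = (x - c') - (c - c')" by auto
    show "y \<in> span ((\<lambda>x. x - c') ` A)"
      unfolding x(2) using x(1) that by (intro span_diff span_base imageI)
  qed
  show ?thesis
    using *[OF assms(2,3)] *[OF assms(3,2)] by (metis span_mono span_span subset_antisym)
qed

text \<open>The base point in the definition is an arbitrary \<open>SOME\<close>. It differs from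
  \<open>u\<close> by a vector of \<open>span B\<close>, so translation invariance moves it to
  \<open>u\<close>, while the chosen basis is kept.\<close>

lemma affine_lborel_eq_distr_span_lborel:
  fixes A :: "'a::euclidean_space set"
  assumes A: "affine A" and u: "u \<in> A"
  obtains B where "orthonormal_set B" "span B = (\<lambda>x. x - u) ` A" "aff_dim A = int (card B)"
    "affine_lborel A = distr (span_lborel B) borel (\<lambda>x. u + x)"
proof -
  define a where "a = (SOME a. a \<in> A)"
  have a: "a \<in> A"
    unfolding a_def using u by (rule someI)
  let ?Q = "\<lambda>B. pairwise orthogonal B \<and> (\<forall>b\<in>B. norm b = 1) \<and> span B = span ((\<lambda>x. x - a) ` A)"
  define B where "B = (SOME B. ?Q B)"
  obtain B0 where "B0 \<subseteq> span ((\<lambda>x. x - a) ` A)" "pairwise orthogonal B0" "\<And>x. x \<in> B0 \<Longrightarrow> norm x = 1"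
     "span B0 = span ((\<lambda>x. x - a) ` A)"
    using orthonormal_basis_subspace[OF subspace_span, of "(\<lambda>x. x - a) ` A"] by metis
  then have "?Q B0" by auto
  then have QB: "?Q B"
    unfolding B_def by (rule someI)
  then have B: "orthonormal_set B"
    by (simp add: orthonormal_set_def)
  note fin = orthonormal_set_independent(2)[OF B]
  have sub: "subspace ((\<lambda>x. x - u) ` A)"
    using affine_diffs_subspace_subtract[OF A u] by simp
  have sp: "span B = (\<lambda>x. x - u) ` A"
    using QB span_diff_eq_affine[OF A a u] span_eq_iff[THEN iffD2, OF sub] by simp
  have "aff_dim A = int (dim ((\<lambda>x. x - u) ` A))"
    using aff_dim_dim_affine_diffs[OF A u] aff_dim_eq_dim_subtract[of u A] u by (simp add: hull_inc)
  also have "dim ((\<lambda>x. x - u) ` A) = card B"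
    by (metis sp dim_span dim_eq_card_independent orthonormal_set_independent(1)[OF B])
  finally have dim: "aff_dim A = int (card B)" .
  have eqA: "affine_lborel A = distr (\<Pi>\<^sub>M b\<in>B. lborel) borel (\<lambda>g. a + (\<Sum>b\<in>B. g b *\<^sub>R b))"
    unfolding affine_lborel_def Let_def a_def[symmetric] B_def by simp
  have "a - u \<in> span B"
    using a sp by auto
  have "affine_lborel A = distr (span_lborel B) borel (\<lambda>x. u + x)"
  proof (rule measure_eqI)
    fix X assume "X \<in> sets (affine_lborel A)"
    then have X[measurable]: "X \<in> sets borel"
      by (simp add: eqA)
    have "emeasure (affine_lborel A) X = (\<integral>\<^sup>+x. indicator X x \<partial>affine_lborel A)"
      using X by (subst nn_integral_indicator) (auto simp: eqA)
    also have "\<dots> = (\<integral>\<^sup>+g. indicator X (a + (\<Sum>b\<in>B. g b *\<^sub>R b)) \<partial>(\<Pi>\<^sub>M b\<in>B. lborel))"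
      unfolding eqA by (subst nn_integral_distr) auto
    also have "\<dots> = (\<integral>\<^sup>+x. indicator X (u + ((a - u) + 1 *\<^sub>R x)) \<partial>span_lborel B)"
      unfolding span_lborel_def by (subst nn_integral_distr) auto
    also have "\<dots> = (\<integral>\<^sup>+x. indicator X (u + x) \<partial>span_lborel B)"
      using nn_integral_span_lborel_affine[OF B, of 1 "a - u" "\<lambda>x. indicator X (u + x)"]
        \<open>a - u \<in> span B\<close> by simp
    also have "\<dots> = (\<integral>\<^sup>+x. indicator X x \<partial>distr (span_lborel B) borel (\<lambda>x. u + x))"
      by (subst nn_integral_distr) auto
    also have "\<dots> = emeasure (distr (span_lborel B) borel (\<lambda>x. u + x)) X"
      by simp
    finally show "emeasure (affine_lborel A) X = emeasure (distr (span_lborel B) borel (\<lambda>x. u + x)) X" .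
  qed (simp add: eqA)
  then show thesis
    using that[OF B sp dim] by blast
qed

section \<open>Subsets of star-shaped sets\<close>

text \<open>\<open>L\<close> is the supremum of the parameters in \<open>W\<close>; star-shapedness
  fills in everything below it. Whether the endpoint belongs to \<open>W\<close> is left open and
  does not affect the length.\<close>

lemma ray_in_star:
  fixes W :: "'a::euclidean_space set"
  assumes W[measurable]: "W \<in> sets borel" and bd: "bounded W"
    and star: "\<And>x s. x \<in> W \<Longrightarrow> 0 \<le> s \<Longrightarrow> s \<le> 1 \<Longrightarrow> s *\<^sub>R x \<in> W"
    and x: "x \<in> W" "x \<noteq> 0"
  obtains L where "L \<ge> 1" "\<And>s. 0 < s \<Longrightarrow> s < L \<Longrightarrow> s *\<^sub>R x \<in> W" "\<And>s. s *\<^sub>R x \<in> W \<Longrightarrow> s \<le> L"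
    "emeasure lborel {s. 0 < s \<and> s *\<^sub>R x \<in> W} = ennreal L"
proof -
  let ?T = "{s. 0 < s \<and> s *\<^sub>R x \<in> W}"
  obtain b where b: "\<And>y. y \<in> W \<Longrightarrow> norm y \<le> b"
    using bd by (auto simp: bounded_iff)
  have 1: "1 \<in> ?T"
    using x by simp
  have "s \<le> b / norm x" if "s \<in> ?T" for s
    using b[of "s *\<^sub>R x"] that x by (simp add: field_simps)
  then have bdd: "bdd_above ?T"
    by (auto intro!: bdd_aboveI)
  define L where "L = Sup ?T"
  have up: "s \<le> L" if "s *\<^sub>R x \<in> W" for s
  proof (cases "s > 0")
    case True
    then show ?thesis
      unfolding L_def using that by (intro cSup_upper bdd) auto
  next
    case False
    then show ?thesis
      unfolding L_def using cSup_upper[OF 1 bdd] by simp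
  qed
  have low: "s *\<^sub>R x \<in> W" if s: "0 < s" "s < L" for s
  proof -
    obtain r where r: "r \<in> ?T" "s < r"
      using s(2) 1 less_cSup_iff[OF _ bdd, of s] unfolding L_def by blast
    then have "(s / r) *\<^sub>R (r *\<^sub>R x) \<in> W"
      using s by (intro star[of "r *\<^sub>R x" "s / r"]) auto
    then show ?thesis
      using r s by simp
  qed
  have L1: "L \<ge> 1"
    using up[of 1] x by simp
  have T: "?T \<in> sets lborel"
    by simp
  have "emeasure lborel {0<..<L} \<le> emeasure lborel ?T"
    using low by (intro emeasure_mono T) auto
  moreover have "emeasure lborel ?T \<le> emeasure lborel {0<..L}"
    using up by (intro emeasure_mono) auto
  ultimately have "emeasure lborel ?T = ennreal L"
    using L1 by simp
  then show thesis
    using that L1 low up by blast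
qed

text \<open>The antiderivative is \<open>- 1 / (k * s ^ k)\<close>. With \<open>a = 1 / L\<close>
  the value is \<open>L ^ k / k\<close>, from which the factor \<open>k\<close> of the volume bound
  arises.\<close>

lemma nn_integral_inverse_power:
  assumes "a > 0" "k \<ge> 1"
  shows "(\<integral>\<^sup>+s. ennreal (1 / s ^ (k + 1)) * indicator {a<..} s \<partial>lborel) = ennreal (1 / (real k * a ^ k))"
proof -
  have "(\<integral>\<^sup>+s. ennreal (1 / s ^ (k + 1)) * indicator {a<..} s \<partial>lborel)
      = (\<integral>\<^sup>+s. ennreal (1 / s ^ (k + 1)) * indicator {a..} s \<partial>lborel)"
    using AE_lborel_singleton[of a] by (intro nn_integral_cong_AE) (auto simp: indicator_def elim!: eventually_mono)
  also have "\<dots> = ennreal (0 - (- 1 / (real k * a ^ k)))"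
  proof (rule nn_integral_FTC_atLeast)
    show "((\<lambda>s. - 1 / (real k * s ^ k)) has_real_derivative 1 / x ^ (k + 1)) (at x)" if "a \<le> x" for x
    proof -
      obtain m where m: "k = Suc m"
        using assms(2) by (cases k) auto
      have "((\<lambda>s. - (1 / real k) * inverse s ^ k) has_real_derivative
          - (1 / real k) * ((1 + real m) * (- (inverse x ^ Suc (Suc 0)) * inverse x ^ m))) (at x)"
        unfolding m using that assms by (intro DERIV_cmult DERIV_power_Suc DERIV_inverse) auto
      also have "- (1 / real k) * ((1 + real m) * (- (inverse x ^ Suc (Suc 0)) * inverse x ^ m)) = 1 / x ^ (k + 1)"
        using that assms by (simp add: m field_simps power2_eq_square)
      finally show ?thesis
        by (simp add: power_inverse divide_inverse mult.commute)
    qed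
    show "((\<lambda>s. - 1 / (real k * s ^ k)) \<longlongrightarrow> 0) at_top"
    proof -
      have "filterlim (\<lambda>s::real. s ^ k) at_top at_top"
        using assms by (intro filterlim_pow_at_top filterlim_ident) auto
      then have "filterlim (\<lambda>s::real. real k * s ^ k) at_top at_top"
        using assms by (intro filterlim_tendsto_pos_mult_at_top[OF tendsto_const]) auto
      then show ?thesis
        by (intro tendsto_divide_0[OF tendsto_const] filterlim_at_top_imp_at_infinity)
    qed
  qed (use assms in auto)
  finally show ?thesis
    by simp
qed

text \<open>The origin is fixed by the dilation by 2, so its finite mass equals
  \<open>2 ^ card B\<close> times itself.\<close>

lemma emeasure_span_lborel_0:
  fixes B :: "'a::euclidean_space set"
  assumes B: "orthonormal_set B" and k: "card B \<ge> 1"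
  shows "emeasure (span_lborel B) {0} = 0"
proof -
  let ?m = "emeasure (span_lborel B) {0}"
  have "?m = (\<integral>\<^sup>+x. indicator {0} x \<partial>span_lborel B)"
    by simp
  also have "\<dots> = ennreal (2 ^ card B) * (\<integral>\<^sup>+x. indicator {0} (0 + 2 *\<^sub>R x) \<partial>span_lborel B)"
    by (intro nn_integral_span_lborel_affine B) (auto simp: span_zero)
  also have "(\<lambda>x::'a. indicator {0} (0 + 2 *\<^sub>R x)) = (indicator {0} :: 'a \<Rightarrow> ennreal)"
    by (auto simp: fun_eq_iff indicator_def)
  finally have *: "?m = ennreal (2 ^ card B) * ?m"
    by simp
  have "?m < \<infinity>"
    using emeasure_span_lborel_cball_finite[OF B, of 0] by simp
  then obtain r where r: "r \<ge> 0" "?m = ennreal r"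
    by (cases ?m) auto
  then have "r = 2 ^ card B * r"
    using * by (simp flip: ennreal_mult)
  moreover have "(1::real) < 2 ^ card B"
    using k by (intro one_less_power) auto
  ultimately show ?thesis
    using r by simp
qed

text \<open>
  This replaces integration in polar coordinates. With \<open>L x\<close> the length of the ray through
  \<open>x\<close> in the parametrisation \<open>s \<mapsto> s x\<close>, the double integral of \<open>s\<^bsup>k - 1\<^esup> / L x\<^bsup>k\<^esup>\<close> over all
  \<open>x \<in> W\<close>, \<open>s > 0\<close> with \<open>s x \<in> E\<close> is at most \<open>c |W|\<close> when \<open>s\<close> is integrated first, and after the
  substitution \<open>y = s x\<close> it is \<open>|E| / k\<close>.
\<close>
lemma emeasure_star_le:
  fixes B :: "'a::euclidean_space set"
  assumes B: "orthonormal_set B" and k: "card B \<ge> 1"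
    and W[measurable]: "W \<in> sets borel" and bd: "bounded W"
    and star: "\<And>x s. x \<in> W \<Longrightarrow> 0 \<le> s \<Longrightarrow> s \<le> 1 \<Longrightarrow> s *\<^sub>R x \<in> W"
    and E[measurable]: "E \<in> sets borel" and EW: "E \<subseteq> W" and c: "c \<ge> 0"
    and ray: "\<And>x. x \<in> W \<Longrightarrow> x \<noteq> 0 \<Longrightarrow> emeasure lborel {s. 0 < s \<and> s *\<^sub>R x \<in> E}
                  \<le> ennreal c * emeasure lborel {s. 0 < s \<and> s *\<^sub>R x \<in> W}"
  shows "emeasure (span_lborel B) E \<le> ennreal (real (card B) * c) * emeasure (span_lborel B) W"
proof -
  let ?N = "span_lborel B" and ?k = "card B"
  interpret N: sigma_finite_measure ?N
    by (rule sigma_finite_span_lborel[OF B])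
  interpret P: pair_sigma_finite lborel ?N ..
  have ne0: "AE x in ?N. x \<noteq> 0"
    using emeasure_span_lborel_0[OF B k] by (intro AE_I[where N="{0}"]) auto
  \<comment> \<open>Writing the ray length as an integral makes it measurable in \<open>x\<close>.
    Its real version \<open>L\<close> is the true length for nonzero points of \<open>W\<close>; the
    origin is a null set and is excluded below.\<close>
  define l where "l x = (\<integral>\<^sup>+s. indicator {0<..} s * indicator W (s *\<^sub>R x) \<partial>lborel)" for x
  define L where "L x = enn2real (l x)" for x
  have [measurable]: "L \<in> borel_measurable borel"
    unfolding L_def l_def by measurable
  have l_eq: "l x = emeasure lborel {s. 0 < s \<and> s *\<^sub>R x \<in> W}" for x
  proof -
    have "l x = (\<integral>\<^sup>+s. indicator {s. 0 < s \<and> s *\<^sub>R x \<in> W} s \<partial>lborel)"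
      unfolding l_def by (intro nn_integral_cong) (auto simp: indicator_def)
    then show ?thesis by simp
  qed
  have L: "L x \<ge> 1" "\<And>s. 0 < s \<Longrightarrow> s < L x \<Longrightarrow> s *\<^sub>R x \<in> W" "\<And>s. s *\<^sub>R x \<in> W \<Longrightarrow> s \<le> L x"
    "emeasure lborel {s. 0 < s \<and> s *\<^sub>R x \<in> W} = ennreal (L x)"
    if x: "x \<in> W" "x \<noteq> 0" for x
  proof -
    obtain L' where L': "L' \<ge> 1" "\<And>s. 0 < s \<Longrightarrow> s < L' \<Longrightarrow> s *\<^sub>R x \<in> W" "\<And>s. s *\<^sub>R x \<in> W \<Longrightarrow> s \<le> L'"
      "emeasure lborel {s. 0 < s \<and> s *\<^sub>R x \<in> W} = ennreal L'"
      using ray_in_star[OF W bd star x] by blast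
    moreover have "L x = L'"
      using L'(1,4) by (simp add: L_def l_eq)
    ultimately show "L x \<ge> 1" "\<And>s. 0 < s \<Longrightarrow> s < L x \<Longrightarrow> s *\<^sub>R x \<in> W" "\<And>s. s *\<^sub>R x \<in> W \<Longrightarrow> s \<le> L x"
      "emeasure lborel {s. 0 < s \<and> s *\<^sub>R x \<in> W} = ennreal (L x)"
      by auto
  qed
  have L_scale: "L ((1 / s) *\<^sub>R x) = s * L x" if s: "s > 0" for s x
  proof -
    have "l ((1 / s) *\<^sub>R x) = ennreal \<bar>s\<bar> *
        (\<integral>\<^sup>+u. indicator {0<..} (0 + s * u) * indicator W ((0 + s * u) *\<^sub>R ((1 / s) *\<^sub>R x)) \<partial>lborel)"
      unfolding l_def using s by (intro nn_integral_real_affine) auto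
    also have "\<dots> = ennreal s * l x"
      unfolding l_def using s
      by (intro arg_cong2[where f="(*)"] nn_integral_cong) (auto simp: indicator_def zero_less_mult_iff)
    finally show ?thesis
      using s by (simp add: L_def enn2real_mult)
  qed
  define F where "F x s = indicator W x * indicator {0<..} s * indicator E (s *\<^sub>R x)
      * ennreal (s ^ (?k - 1) / L x ^ ?k)" for x s
  \<comment> \<open>\<open>G\<close> is \<open>F\<close> after the substitution
    \<open>x = y / s\<close>: the Jacobian contributes \<open>s^-k\<close>, and
    \<open>L (y / s) = s * L y\<close> contributes another \<open>s^-k\<close>.\<close>
  define G where "G y s = indicator E y * indicator {0<..} s * indicator W ((1 / s) *\<^sub>R y)
      * ennreal (1 / s ^ (?k + 1) / L y ^ ?k)" for y s
  have [measurable]: "case_prod F \<in> borel_measurable (borel \<Otimes>\<^sub>M borel)"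
    unfolding F_def by measurable
  have [measurable]: "case_prod G \<in> borel_measurable (borel \<Otimes>\<^sub>M borel)"
    unfolding G_def by measurable
  \<comment> \<open>Since \<open>E \<subseteq> W\<close>, only \<open>s \<le> L x\<close> occurs, so
    the weight is at most \<open>1 / L x\<close>. The ray hypothesis bounds the total length of
    these \<open>s\<close> by \<open>c * L x\<close>.\<close>
  have up: "(\<integral>\<^sup>+s. F x s \<partial>lborel) \<le> ennreal c * indicator W x" if x: "x \<noteq> 0" for x
  proof (cases "x \<in> W")
    case True
    note Lx = L[OF True x]
    have "(\<integral>\<^sup>+s. F x s \<partial>lborel) \<le> (\<integral>\<^sup>+s. ennreal (1 / L x) * indicator {s. 0 < s \<and> s *\<^sub>R x \<in> E} s \<partial>lborel)"
    proof (intro nn_integral_mono)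
      fix s
      have "s ^ (?k - 1) / L x ^ ?k \<le> 1 / L x" if "0 < s" "s *\<^sub>R x \<in> E"
      proof -
        have "s ^ (?k - 1) \<le> L x ^ (?k - 1)"
          using that EW Lx(3) by (intro power_mono) auto
        moreover have "L x ^ ?k = L x * L x ^ (?k - 1)"
          using k by (cases ?k) auto
        ultimately show ?thesis
          using Lx(1) by (simp add: field_simps)
      qed
      then show "F x s \<le> ennreal (1 / L x) * indicator {s. 0 < s \<and> s *\<^sub>R x \<in> E} s"
        by (auto simp: F_def indicator_def intro!: ennreal_leI)
    qed
    also have "\<dots> = ennreal (1 / L x) * emeasure lborel {s. 0 < s \<and> s *\<^sub>R x \<in> E}"
      by (subst nn_integral_cmult_indicator) auto
    also have "\<dots> \<le> ennreal (1 / L x) * (ennreal c * ennreal (L x))"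
      using ray[OF True x] Lx(4) by (intro mult_left_mono) auto
    also have "\<dots> = ennreal c"
      using Lx(1) c by (simp flip: ennreal_mult)
    finally show ?thesis using True by simp
  next
    case False
    then show ?thesis by (simp add: F_def)
  qed
  \<comment> \<open>For \<open>y \<in> E\<close> every \<open>s > 1 / L y\<close> has
    \<open>y / s \<in> W\<close>, and the weight of \<open>G\<close> over these \<open>s\<close>
    alone already integrates to \<open>1 / k\<close>.\<close>
  have low: "indicator E y \<le> ennreal (real ?k) * (\<integral>\<^sup>+s. G y s \<partial>lborel)" if y: "y \<noteq> 0" for y
  proof (cases "y \<in> E")
    case True
    then have Ly: "L y \<ge> 1" "\<And>s. 0 < s \<Longrightarrow> s < L y \<Longrightarrow> s *\<^sub>R y \<in> W"
      using L[of y] y EW by auto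
    have "1 = ennreal (real ?k) * (ennreal (1 / L y ^ ?k) * ennreal (1 / (real ?k * (1 / L y) ^ ?k)))"
      using Ly(1) k by (simp add: field_simps flip: ennreal_mult)
    also have "\<dots> = ennreal (real ?k) * (ennreal (1 / L y ^ ?k) *
       (\<integral>\<^sup>+s. ennreal (1 / s ^ (?k + 1)) * indicator {1 / L y<..} s \<partial>lborel))"
      using Ly(1) k by (subst nn_integral_inverse_power) auto
    also have "\<dots> = ennreal (real ?k) *
       (\<integral>\<^sup>+s. ennreal (1 / L y ^ ?k) * (ennreal (1 / s ^ (?k + 1)) * indicator {1 / L y<..} s) \<partial>lborel)"
      by (subst nn_integral_cmult) auto
    also have "\<dots> \<le> ennreal (real ?k) * (\<integral>\<^sup>+s. G y s \<partial>lborel)"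
    proof (intro mult_left_mono nn_integral_mono)
      fix s
      show "ennreal (1 / L y ^ ?k) * (ennreal (1 / s ^ (?k + 1)) * indicator {1 / L y<..} s) \<le> G y s"
      proof (cases "s > 1 / L y")
        case s: True
        then have "s > 0"
          using Ly(1) by (meson divide_pos_pos le_less_trans less_eq_real_def less_le_trans zero_less_one)
        moreover have "1 / s < L y"
          using s Ly(1) \<open>s > 0\<close> by (simp add: field_simps)
        ultimately show ?thesis
          using s True Ly(1) Ly(2)[of "1 / s"] by (simp add: G_def field_simps flip: ennreal_mult)
      qed simp
    qed simp
    finally show ?thesis using True by simp
  qed simp
  have swap: "(\<integral>\<^sup>+x. F x s \<partial>?N) = (\<integral>\<^sup>+y. G y s \<partial>?N)" for s
  proof (cases "s > 0")
    case True
    have "(\<integral>\<^sup>+x. F x s \<partial>?N) = ennreal ((1 / s) ^ ?k) * (\<integral>\<^sup>+y. F (0 + (1 / s) *\<^sub>R y) s \<partial>?N)"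
      using True by (intro nn_integral_span_lborel_affine B) (auto simp: span_zero)
    also have "\<dots> = (\<integral>\<^sup>+y. ennreal ((1 / s) ^ ?k) * F (0 + (1 / s) *\<^sub>R y) s \<partial>?N)"
      by (subst nn_integral_cmult) auto
    also have "\<dots> = (\<integral>\<^sup>+y. G y s \<partial>?N)"
    proof (intro nn_integral_cong)
      fix y
      obtain m where m: "?k = Suc m"
        using k by (cases ?k) auto
      have "L y \<ge> 0"
        by (simp add: L_def)
      then have "ennreal ((1 / s) ^ ?k) * ennreal (s ^ (?k - 1) / (s * L y) ^ ?k)
          = ennreal (1 / s ^ (?k + 1) / L y ^ ?k)"
        using True by (subst ennreal_mult[symmetric]) (auto simp: m power_mult_distrib field_simps)
      then show "ennreal ((1 / s) ^ ?k) * F (0 + (1 / s) *\<^sub>R y) s = G y s"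
        using True unfolding F_def G_def add_0_left L_scale[OF True]
        by (auto simp: indicator_def)
    qed
    finally show ?thesis .
  qed (simp add: F_def G_def)
  have "emeasure ?N E = (\<integral>\<^sup>+y. indicator E y \<partial>?N)"
    by simp
  also have "\<dots> \<le> (\<integral>\<^sup>+y. ennreal (real ?k) * (\<integral>\<^sup>+s. G y s \<partial>lborel) \<partial>?N)"
    using ne0 low by (intro nn_integral_mono_AE) (auto elim!: eventually_mono)
  also have "\<dots> = ennreal (real ?k) * (\<integral>\<^sup>+y. (\<integral>\<^sup>+s. G y s \<partial>lborel) \<partial>?N)"
    by (intro nn_integral_cmult) measurable
  also have "(\<integral>\<^sup>+y. (\<integral>\<^sup>+s. G y s \<partial>lborel) \<partial>?N) = (\<integral>\<^sup>+s. (\<integral>\<^sup>+y. G y s \<partial>?N) \<partial>lborel)"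
    by (intro P.Fubini') measurable
  also have "\<dots> = (\<integral>\<^sup>+s. (\<integral>\<^sup>+x. F x s \<partial>?N) \<partial>lborel)"
    by (simp add: swap)
  also have "\<dots> = (\<integral>\<^sup>+x. (\<integral>\<^sup>+s. F x s \<partial>lborel) \<partial>?N)"
    by (intro P.Fubini'[symmetric]) measurable
  also have "\<dots> \<le> (\<integral>\<^sup>+x. ennreal c * indicator W x \<partial>?N)"
    using ne0 up by (intro nn_integral_mono_AE) (auto elim!: eventually_mono)
  also have "\<dots> = ennreal c * emeasure ?N W"
    by (subst nn_integral_cmult_indicator) auto
  finally show ?thesis
    using c by (simp add: ennreal_mult mult.assoc mult_left_mono)
qed

section \<open>Sublevel sets on convex sets\<close>

text \<open>The relative interior is relatively open in the affine hull, which is closed.\<close>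

lemma rel_interior_borel [measurable]:
  "rel_interior S \<in> sets (borel :: 'a::euclidean_space measure)"
proof -
  obtain U where "open U" "rel_interior S = affine hull S \<inter> U"
    using openin_rel_interior[of S] by (auto simp: openin_open)
  then show ?thesis
    by (simp add: borel_closed borel_open sets.Int)
qed

text \<open>For \<open>s > 1\<close> the closure of \<open>S\<close> lies in the dilate of its relative interior by \<open>s\<close>.\<close>
lemma emeasure_span_lborel_closure_le:
  fixes S :: "'a::euclidean_space set"
  assumes B: "orthonormal_set B" and S: "convex S" "bounded S" and 0: "0 \<in> rel_interior S"
  shows "emeasure (span_lborel B) (closure S) \<le> emeasure (span_lborel B) (rel_interior S)"
proof -
  let ?N = "span_lborel B"
  have "emeasure ?N (rel_interior S) < \<infinity>"
    using S(2) rel_interior_subset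
    by (intro emeasure_span_lborel_bounded_finite B) (rule bounded_subset)
  then obtain w where w: "w \<ge> 0" "emeasure ?N (rel_interior S) = ennreal w"
    by (cases "emeasure ?N (rel_interior S)") auto
  have le: "emeasure ?N (closure S) \<le> ennreal (s ^ card B * w)" if s: "s > 1" for s
  proof -
    have "emeasure ?N (closure S) = (\<integral>\<^sup>+x. indicator (closure S) x \<partial>?N)"
      by simp
    also have "\<dots> = ennreal (s ^ card B) * (\<integral>\<^sup>+x. indicator (closure S) (0 + s *\<^sub>R x) \<partial>?N)"
      using s by (intro nn_integral_span_lborel_affine B) (auto simp: span_zero)
    also have "\<dots> \<le> ennreal (s ^ card B) * (\<integral>\<^sup>+x. indicator (rel_interior S) x \<partial>?N)"
    proof (intro mult_left_mono nn_integral_mono)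
      fix x
      have "x \<in> rel_interior S" if "s *\<^sub>R x \<in> closure S"
      proof -
        have "s *\<^sub>R x - (1 - 1 / s) *\<^sub>R (s *\<^sub>R x - 0) \<in> rel_interior S"
          using s by (intro rel_interior_closure_convex_shrink S 0 that) auto
        then show ?thesis
          using s by (simp add: algebra_simps)
      qed
      then show "indicator (closure S) (0 + s *\<^sub>R x) \<le> (indicator (rel_interior S) x :: ennreal)"
        by (auto simp: indicator_def)
    qed simp
    also have "\<dots> = ennreal (s ^ card B * w)"
      using s w by (simp add: ennreal_mult)
    finally show ?thesis .
  qed
  \<comment> \<open>The factor \<open>s ^ card B\<close> disappears as the dilation factor decreases
    to 1.\<close>
  have "((\<lambda>s::real. ennreal (s ^ card B * w)) \<longlongrightarrow> ennreal (1 ^ card B * w)) (at_right 1)"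
    by (intro tendsto_intros)
  then have "emeasure ?N (closure S) \<le> ennreal (1 ^ card B * w)"
    by (rule tendsto_lowerbound)
      (auto intro!: le eventually_mono[OF eventually_at_right_less[of "1::real"]])
  then show ?thesis
    using w by simp
qed

text \<open>In dimension one the basis is a single unit vector \<open>b\<close>, and
  \<open>x = \<beta> *\<^sub>R b\<close> with \<open>\<bar>\<beta>\<bar> = norm x\<close>; the
  substitution does not see the sign of \<open>\<beta>\<close>. This translates the measure in
  \<open>chebyshev_constant\<close> into Lebesgue measure of ray parameters.\<close>

lemma emeasure_affine_lborel_line:
  fixes u x :: "'a::euclidean_space"
  assumes I: "aff_dim I = 1" "u \<in> I" "u + x \<in> I" "x \<noteq> 0" and X[measurable]: "X \<in> sets borel"
  shows "emeasure (affine_lborel (affine hull I)) X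
    = ennreal (norm x) * emeasure lborel {s. u + s *\<^sub>R x \<in> X}"
proof -
  have u: "u \<in> affine hull I" "u + x \<in> affine hull I"
    using I by (auto simp: hull_inc)
  obtain B where B: "orthonormal_set B" "span B = (\<lambda>x. x - u) ` (affine hull I)"
    "aff_dim (affine hull I) = int (card B)"
    "affine_lborel (affine hull I) = distr (span_lborel B) borel (\<lambda>x. u + x)"
    using affine_lborel_eq_distr_span_lborel[OF affine_affine_hull u(1)] by blast
  have "card B = 1"
    using B(3) I(1) by simp
  then obtain b where b: "B = {b}"
    by (auto simp: card_1_singleton_iff)
  have nb: "norm b = 1"
    using B(1) by (simp add: b orthonormal_set_def)
  have "x \<in> span B"
    unfolding B(2) using u(2) by (intro image_eqI[of _ _ "u + x"]) auto
  then obtain \<beta> where \<beta>: "x = \<beta> *\<^sub>R b"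
    by (auto simp: b span_singleton)
  have \<beta>0: "\<beta> \<noteq> 0" "\<bar>\<beta>\<bar> = norm x"
    using \<beta> I(4) nb by auto
  interpret product_sigma_finite "\<lambda>i::'a. lborel :: real measure" by standard
  have "emeasure (affine_lborel (affine hull I)) X = (\<integral>\<^sup>+y. indicator X y \<partial>affine_lborel (affine hull I))"
    by (subst nn_integral_indicator) (auto simp: B(4))
  also have "\<dots> = (\<integral>\<^sup>+g. indicator X (u + g b *\<^sub>R b) \<partial>(\<Pi>\<^sub>M i\<in>{b}. lborel))"
    unfolding B(4) span_lborel_def b by (subst nn_integral_distr, simp, simp)+ simp
  also have "\<dots> = (\<integral>\<^sup>+s. indicator X (u + s *\<^sub>R b) \<partial>lborel)"
    by (intro product_nn_integral_singleton[where f="\<lambda>s. indicator X (u + s *\<^sub>R b)"]) simp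
  also have "\<dots> = ennreal \<bar>\<beta>\<bar> * (\<integral>\<^sup>+s. indicator X (u + (0 + \<beta> * s) *\<^sub>R b) \<partial>lborel)"
    using \<beta>0 by (intro nn_integral_real_affine) auto
  also have "(\<integral>\<^sup>+s. indicator X (u + (0 + \<beta> * s) *\<^sub>R b) \<partial>lborel)
      = (\<integral>\<^sup>+s. indicator {s. u + s *\<^sub>R x \<in> X} s \<partial>lborel)"
    by (intro nn_integral_cong) (auto simp: indicator_def \<beta> mult.commute)
  also have "\<dots> = emeasure lborel {s. u + s *\<^sub>R x \<in> X}"
    by (intro nn_integral_indicator) measurable
  finally show ?thesis
    by (simp add: \<beta>0)
qed

text \<open>On the part of the ray inside \<open>W\<close> the supremum of \<open>norm (h v)\<close>
  is at least \<open>norm (h v0)\<close>, and on the part inside \<open>E\<close> it is at most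
  \<open>\<tau>\<close>. If these parts have parameter lengths \<open>a\<close> and
  \<open>b\<close>, the Chebyshev inequality gives
  \<open>norm (h v0) \<le> (4 * a / b) powr \<delta> * \<tau>\<close>, since the scale
  \<open>norm x\<close> cancels in the ratio; solving for \<open>b\<close> is the claim.\<close>

lemma chebyshev_constant_ray:
  fixes h :: "complex^'s \<Rightarrow> complex"
  assumes d: "chebyshev_constant h d" "d \<le> \<delta>" "0 < \<delta>"
    and W[measurable]: "W \<in> sets borel" and cW: "convex W" and sub: "W \<subseteq> ball 0 1"
    and v0: "v0 \<in> W" "h v0 \<noteq> 0"
    and E[measurable]: "E \<in> sets borel" and EW: "E \<subseteq> W" and \<tau>: "\<And>v. v \<in> E \<Longrightarrow> norm (h v) \<le> \<tau>" "\<tau> > 0"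
    and x: "v0 + x \<in> W" "x \<noteq> 0"
  shows "emeasure lborel {s. 0 < s \<and> v0 + s *\<^sub>R x \<in> E}
     \<le> ennreal (4 * (\<tau> / norm (h v0)) powr (1 / \<delta>)) * emeasure lborel {s. 0 < s \<and> v0 + s *\<^sub>R x \<in> W}"
proof -
  define r where "r = (\<lambda>s. v0 + s *\<^sub>R x)"
  have [measurable]: "r \<in> borel_measurable borel"
    by (simp add: r_def)
  have inj: "r s \<in> r ` {0..} \<longleftrightarrow> 0 \<le> s" for s
    using x(2) by (auto simp: r_def)
  have img: "r ` {0..} = (+) v0 ` (\<lambda>s. s *\<^sub>R x) ` {0..}"
    by (auto simp: r_def image_image)
  have lin: "linear (\<lambda>s. s *\<^sub>R x)"
    by (simp add: bounded_linear.linear bounded_linear_scaleR_left)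
  have "closed (r ` {0..})"
    unfolding img using x(2) by (intro closed_translation closed_injective_linear_image lin) (auto simp: inj_def)
  then have [measurable]: "r ` {0..} \<in> sets borel"
    by (rule borel_closed)
  have "convex (r ` {0..})"
    unfolding img by (intro convex_translation convex_linear_image lin) auto
  define I where "I = W \<inter> r ` {0..}"
  define \<omega> where "\<omega> = E \<inter> r ` {0..}"
  have [measurable]: "I \<in> sets borel" "\<omega> \<in> sets borel"
    by (simp_all add: I_def \<omega>_def)
  have convI: "convex I"
    unfolding I_def by (intro convex_Int cW \<open>convex (r ` {0..})\<close>)
  have memI: "v0 \<in> I" "v0 + x \<in> I"
    using v0 x inj[of 0] inj[of 1] by (auto simp: I_def r_def)
  have "I \<subseteq> affine hull {v0, v0 + x}"
  proof
    fix y assume "y \<in> I"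
    then obtain s where "y = v0 + s *\<^sub>R x"
      by (auto simp: I_def r_def)
    then have "y = (1 - s) *\<^sub>R v0 + s *\<^sub>R (v0 + x)"
      by (simp add: algebra_simps)
    then show "y \<in> affine hull {v0, v0 + x}"
      unfolding affine_hull_2 by force
  qed
  then have "aff_dim I \<le> aff_dim {v0, v0 + x}"
    by (metis aff_dim_subset aff_dim_affine_hull)
  moreover have "aff_dim {v0, v0 + x} \<le> aff_dim I"
    using memI by (intro aff_dim_subset) auto
  ultimately have dimI: "aff_dim I = 1"
    using x(2) by (simp add: aff_dim_2)
  let ?\<mu> = "affine_lborel (affine hull I)"
  have sets\<mu>: "sets ?\<mu> = sets borel"
    by (simp add: affine_lborel_def Let_def)
  have line: "emeasure ?\<mu> X = ennreal (norm x) * emeasure lborel {s. r s \<in> X}" if "X \<in> sets borel" for X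
    unfolding r_def by (rule emeasure_affine_lborel_line[OF dimI memI x(2) that])
  \<comment> \<open>The segment must contain its endpoint \<open>v0\<close>, where \<open>h\<close>
    is known to be large, whereas the integration over rays uses \<open>s > 0\<close>; the two
    differ by one null parameter.\<close>
  have shape: "emeasure ?\<mu> (X \<inter> r ` {0..}) = ennreal (norm x) * emeasure lborel {s. 0 < s \<and> r s \<in> X}"
    if X[measurable]: "X \<in> sets borel" for X
  proof -
    have "emeasure ?\<mu> (X \<inter> r ` {0..}) = ennreal (norm x) * emeasure lborel {s. r s \<in> X \<inter> r ` {0..}}"
      by (rule line) simp
    also have "emeasure lborel {s. r s \<in> X \<inter> r ` {0..}} = emeasure lborel {s. 0 < s \<and> r s \<in> X}"
    proof (rule emeasure_eq_AE)
      show "AE s in lborel. s \<in> {s. r s \<in> X \<inter> r ` {0..}} \<longleftrightarrow> s \<in> {s. 0 < s \<and> r s \<in> X}"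
        using AE_lborel_singleton[of 0] by eventually_elim (auto simp: inj)
    qed simp_all
    finally show ?thesis .
  qed
  have bd: "emeasure lborel {s. 0 < s \<and> r s \<in> W} < \<infinity>"
  proof -
    have "{s. 0 < s \<and> r s \<in> W} \<subseteq> {0..2 / norm x}"
    proof
      fix s assume s: "s \<in> {s. 0 < s \<and> r s \<in> W}"
      then have "norm (v0 + s *\<^sub>R x) < 1" "norm v0 < 1"
        using sub v0 by (auto simp: r_def)
      then have "norm (s *\<^sub>R x) \<le> 2"
        using norm_triangle_ineq4[of "v0 + s *\<^sub>R x" v0] by simp
      then show "s \<in> {0..2 / norm x}"
        using s x(2) by (simp add: field_simps)
    qed
    then have "emeasure lborel {s. 0 < s \<and> r s \<in> W} \<le> emeasure lborel {0..2 / norm x}"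
      by (intro emeasure_mono) auto
    also have "\<dots> < \<infinity>" by simp
    finally show ?thesis .
  qed
  moreover have "emeasure lborel {s. 0 < s \<and> r s \<in> E} \<le> emeasure lborel {s. 0 < s \<and> r s \<in> W}"
    using EW by (intro emeasure_mono) (auto simp: r_def)
  ultimately obtain a b where ab: "emeasure lborel {s. 0 < s \<and> r s \<in> W} = ennreal a"
    "emeasure lborel {s. 0 < s \<and> r s \<in> E} = ennreal b" "0 \<le> b" "b \<le> a"
    by (cases "emeasure lborel {s. 0 < s \<and> r s \<in> W}"; cases "emeasure lborel {s. 0 < s \<and> r s \<in> E}")
      (auto simp: top_unique)
  have mI: "measure (hull_lebesgue I) I = norm x * a"
    using shape[OF W] ab by (simp add: hull_lebesgue_def sets\<mu> measure_def flip: I_def ennreal_mult)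
  have m\<omega>: "measure (hull_lebesgue I) \<omega> = norm x * b"
    using shape[OF E] ab by (simp add: hull_lebesgue_def sets\<mu> measure_def flip: \<omega>_def ennreal_mult)
  have "b \<le> 4 * (\<tau> / norm (h v0)) powr (1 / \<delta>) * a"
  proof (cases "b = 0")
    case False
    then have b: "b > 0" using ab by simp
    let ?q = "4 * a / b"
    \<comment> \<open>A base of at least 1 is what permits raising the exponent from
      \<open>d\<close> to \<open>\<delta>\<close>.\<close>
    have q: "?q \<ge> 1"
      using ab b by simp
    have "\<omega> \<in> sets (hull_lebesgue I)"
      by (simp add: hull_lebesgue_def sets\<mu>)
    moreover have "\<omega> \<subseteq> I" "I \<subseteq> ball 0 1"
      using EW sub by (auto simp: \<omega>_def I_def)
    moreover have "4 * measure (hull_lebesgue I) I / measure (hull_lebesgue I) \<omega> = ?q"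
      using x(2) by (simp add: mI m\<omega>)
    moreover have "measure (hull_lebesgue I) \<omega> > 0"
      using b x(2) by (simp add: m\<omega>)
    ultimately have "(SUP v\<in>I. ereal (norm (h v))) \<le> ereal (?q powr d) * (SUP v\<in>\<omega>. ereal (norm (h v)))"
      using d(1) convI dimI unfolding chebyshev_constant_def by metis
    also have "\<dots> \<le> ereal (?q powr d) * ereal \<tau>"
      using \<tau>(1) by (intro ereal_mult_left_mono SUP_least) (auto simp: \<omega>_def)
    finally have "ereal (norm (h v0)) \<le> ereal (?q powr d) * ereal \<tau>"
      by (rule order_trans[OF SUP_upper[OF memI(1)]])
    then have "norm (h v0) \<le> ?q powr d * \<tau>"
      by simp
    also have "\<dots> \<le> ?q powr \<delta> * \<tau>"
      using q d(2) \<tau>(2) by (intro mult_right_mono powr_mono) auto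
    finally have "norm (h v0) / \<tau> \<le> ?q powr \<delta>"
      using \<tau>(2) by (simp add: field_simps)
    then have "(norm (h v0) / \<tau>) powr (1 / \<delta>) \<le> (?q powr \<delta>) powr (1 / \<delta>)"
      using d(3) \<tau>(2) by (intro powr_mono2) auto
    also have "\<dots> = ?q"
      using d(3) ab(3,4) b by (simp add: powr_powr)
    finally have "b * (norm (h v0) / \<tau>) powr (1 / \<delta>) \<le> 4 * a"
      using b by (simp add: field_simps)
    moreover have "(norm (h v0) / \<tau>) powr (1 / \<delta>) * (\<tau> / norm (h v0)) powr (1 / \<delta>) = 1"
      using v0(2) \<tau>(2) by (simp flip: powr_mult)
    then have "b = b * (norm (h v0) / \<tau>) powr (1 / \<delta>) * (\<tau> / norm (h v0)) powr (1 / \<delta>)"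
      by (simp add: mult.assoc)
    ultimately show ?thesis
      by (metis mult.assoc mult.commute mult_right_mono powr_ge_zero)
  qed (use ab in auto)
  then show ?thesis
    using ab by (simp add: r_def flip: ennreal_mult)
qed

text \<open>After a point of the relative interior is moved to the origin, the dilation argument
  shows that relative interior and closure have the same finite measure. \<open>V\<close> lies
  between these two Borel sets, hence is measurable for the completion.\<close>

lemma hull_lebesgue_convex:
  fixes V :: "'a::euclidean_space set"
  assumes V: "convex V" "bounded V" "V \<noteq> {}"
  shows "V \<in> fmeasurable (hull_lebesgue V)"
    and "closure V - rel_interior V \<in> null_sets (affine_lborel (affine hull V))"
proof -
  let ?\<mu> = "affine_lborel (affine hull V)"
  have [measurable_cong]: "sets ?\<mu> = sets borel"
    by (simp add: affine_lborel_def Let_def)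
  obtain u where u: "u \<in> rel_interior V"
    using V rel_interior_eq_empty by blast
  then have u': "u \<in> affine hull V"
    using rel_interior_subset[of V] by (auto simp: hull_inc)
  obtain B where B: "orthonormal_set B" "?\<mu> = distr (span_lborel B) borel (\<lambda>x. u + x)"
    by (rule affine_lborel_eq_distr_span_lborel[OF affine_affine_hull u']) (rule that)
  define S where "S = (+) (-u) ` V"
  have S: "convex S" "bounded S" "0 \<in> rel_interior S"
  proof -
    show "convex S" "bounded S"
      unfolding S_def by (intro convex_translation bounded_translation V)+
    have "0 = - u + u"
      by simp
    then show "0 \<in> rel_interior S"
      unfolding S_def rel_interior_translation using u by (rule image_eqI)
  qed
  have tr: "emeasure ?\<mu> X = emeasure (span_lborel B) ((+) (-u) ` X)" if "X \<in> sets borel" for X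
    unfolding B(2) using that by (subst emeasure_distr) (auto simp: vimage_translation)
  have cl: "emeasure ?\<mu> (closure V) = emeasure (span_lborel B) (closure S)"
    unfolding S_def closure_translation by (rule tr) (simp add: borel_closed)
  have ri: "emeasure ?\<mu> (rel_interior V) = emeasure (span_lborel B) (rel_interior S)"
    unfolding S_def rel_interior_translation by (rule tr) (rule rel_interior_borel)
  have le: "emeasure ?\<mu> (closure V) \<le> emeasure ?\<mu> (rel_interior V)"
    unfolding cl ri by (rule emeasure_span_lborel_closure_le[OF B(1) S])
  have fin: "emeasure ?\<mu> (closure V) < \<infinity>"
    unfolding cl by (intro emeasure_span_lborel_bounded_finite B(1) bounded_closure S(2))
  have sub: "rel_interior V \<subseteq> V" "V \<subseteq> closure V"
    using rel_interior_subset closure_subset by auto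
  have "emeasure ?\<mu> (rel_interior V) \<le> emeasure ?\<mu> (closure V)"
    using sub by (intro emeasure_mono) (auto simp: borel_closed)
  then have fin2: "emeasure ?\<mu> (rel_interior V) \<noteq> \<infinity>"
    using fin by auto
  have "emeasure ?\<mu> (closure V - rel_interior V) = emeasure ?\<mu> (closure V) - emeasure ?\<mu> (rel_interior V)"
    using sub fin2 by (intro emeasure_Diff) (auto simp: borel_closed rel_interior_borel)
  also have "\<dots> = 0"
    using le fin by (metis diff_eq_0_ennreal infinity_ennreal_def)
  finally show null: "closure V - rel_interior V \<in> null_sets ?\<mu>"
    by (auto simp: null_sets_def borel_closed rel_interior_borel)
  have Vs: "V \<in> sets (hull_lebesgue V)"
    unfolding hull_lebesgue_def
    by (rule sets_completionI[OF _ _ null, of _ "rel_interior V" "V - rel_interior V"])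
      (use sub in \<open>auto simp: rel_interior_borel\<close>)
  have "emeasure (hull_lebesgue V) V \<le> emeasure (hull_lebesgue V) (closure V)"
    using sub by (intro emeasure_mono) (auto simp: hull_lebesgue_def borel_closed)
  also have "\<dots> < \<infinity>"
    using fin by (simp add: hull_lebesgue_def borel_closed)
  finally show "V \<in> fmeasurable (hull_lebesgue V)"
    using Vs by (intro fmeasurableI) auto
qed

text \<open>For measurable \<open>E\<close> this is monotonicity below a set of finite measure; for
  any other \<open>E\<close> the value of \<open>measure\<close> is 0 by convention.\<close>

lemma measure_hull_lebesgue_le_convex:
  fixes V :: "'a::euclidean_space set"
  assumes V: "convex V" "bounded V" "V \<noteq> {}" and E: "E \<subseteq> V"
  shows "measure (hull_lebesgue V) E \<le> measure (hull_lebesgue V) V"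
proof (cases "E \<in> sets (hull_lebesgue V)")
  case True
  then show ?thesis
    using hull_lebesgue_convex(1)[OF V] E by (intro measure_mono_fmeasurable)
qed (simp add: measure_notin_sets)

text \<open>Seen from \<open>v0\<close> the relative interior is star-shaped. The ray estimate
  bounds the share of the sublevel set on every ray by \<open>c\<close>,
  \<open>emeasure_star_le\<close> turns this into \<open>k * c\<close> for volumes, and the relative
  boundary is null.\<close>

lemma sublevel_measure_le:
  fixes h :: "complex^'s \<Rightarrow> complex"
  assumes d: "chebyshev_constant h d" "d \<le> \<delta>" "0 < \<delta>"
    and V: "convex V" "V \<subseteq> ball 0 1" "aff_dim V = int k" "k \<ge> 1"
    and h: "continuous_on (ball 0 1) h"
    and v0: "v0 \<in> rel_interior V" "h v0 \<noteq> 0" and \<tau>: "\<tau> > 0"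
    and E: "E \<subseteq> {v \<in> V. norm (h v) \<le> \<tau>}"
  shows "measure (hull_lebesgue V) E
     \<le> 4 * real k * (\<tau> / norm (h v0)) powr (1 / \<delta>) * measure (hull_lebesgue V) V"
proof (cases "E \<in> sets (hull_lebesgue V)")
  case Es: True
  let ?\<mu> = "affine_lborel (affine hull V)" and ?W = "rel_interior V"
  define c where "c = 4 * (\<tau> / norm (h v0)) powr (1 / \<delta>)"
  have c: "c \<ge> 0"
    by (simp add: c_def)
  have sets\<mu> [measurable_cong]: "sets ?\<mu> = sets borel"
    by (simp add: affine_lborel_def Let_def)
  have bdV: "bounded V" "V \<noteq> {}"
    using V v0 rel_interior_subset by (auto intro: bounded_subset[OF bounded_ball])
  have sub: "?W \<subseteq> V" "V \<subseteq> closure V"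
    using rel_interior_subset closure_subset by auto
  have v0': "v0 \<in> affine hull V"
    using v0 sub by (auto simp: hull_inc)
  obtain B where B: "orthonormal_set B" "aff_dim (affine hull V) = int (card B)"
    "?\<mu> = distr (span_lborel B) borel (\<lambda>x. v0 + x)"
    by (rule affine_lborel_eq_distr_span_lborel[OF affine_affine_hull v0']) (rule that)
  have k: "card B = k"
    using B(2) V(3) by simp
  \<comment> \<open>\<open>E\<close> need not be Borel. \<open>E'\<close> contains all of it up to
    the relative boundary and is relatively closed in the relative interior, hence Borel.\<close>
  define E' where "E' = {v \<in> ?W. norm (h v) \<le> \<tau>}"
  have E'_sub: "E' \<subseteq> ?W" "\<And>v. v \<in> E' \<Longrightarrow> norm (h v) \<le> \<tau>"
    by (auto simp: E'_def)
  have E'_borel [measurable]: "E' \<in> sets borel"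
  proof -
    have "continuous_on ?W (\<lambda>v. norm (h v))"
      using h sub V(2) by (intro continuous_on_norm continuous_on_subset[OF h]) auto
    then have "closedin (top_of_set ?W) (?W \<inter> (\<lambda>v. norm (h v)) -` {..\<tau>})"
      by (intro continuous_closedin_preimage) auto
    then obtain C where "closed C" "?W \<inter> (\<lambda>v. norm (h v)) -` {..\<tau>} = ?W \<inter> C"
      by (auto simp: closedin_closed)
    moreover have "E' = ?W \<inter> (\<lambda>v. norm (h v)) -` {..\<tau>}"
      by (auto simp: E'_def)
    ultimately show ?thesis
      by (simp add: borel_closed sets.Int rel_interior_borel)
  qed
  have convW: "convex ?W"
    using V(1) by (rule convex_rel_interior)
  have "emeasure (span_lborel B) {x. v0 + x \<in> E'}
      \<le> ennreal (real (card B) * c) * emeasure (span_lborel B) {x. v0 + x \<in> ?W}"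
  proof (rule emeasure_star_le[OF B(1)])
    have eq: "{x. v0 + x \<in> ?W} = (+) (-v0) ` ?W"
      using vimage_translation[of v0 ?W] by (simp add: vimage_def)
    show "bounded {x. v0 + x \<in> ?W}"
      unfolding eq using bdV sub by (intro bounded_translation bounded_subset[OF bdV(1)])
    show "s *\<^sub>R x \<in> {x. v0 + x \<in> ?W}" if "x \<in> {x. v0 + x \<in> ?W}" "0 \<le> s" "s \<le> 1" for x s
    proof -
      have "(1 - s) *\<^sub>R v0 + s *\<^sub>R (v0 + x) \<in> ?W"
        using that v0 by (intro convexD_alt[OF convW]) auto
      then show ?thesis
        by (simp add: algebra_simps)
    qed
    show "emeasure lborel {s. 0 < s \<and> s *\<^sub>R x \<in> {x. v0 + x \<in> E'}}
        \<le> ennreal c * emeasure lborel {s. 0 < s \<and> s *\<^sub>R x \<in> {x. v0 + x \<in> ?W}}"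
      if "x \<in> {x. v0 + x \<in> ?W}" "x \<noteq> 0" for x
      unfolding c_def mem_Collect_eq
      using that v0 sub V(2) \<tau> by (intro chebyshev_constant_ray[OF d] convW E'_borel E'_sub) auto
  qed (use V(4) k c E'_sub in auto)
  then have main: "emeasure ?\<mu> E' \<le> ennreal (real k * c) * emeasure ?\<mu> ?W"
    unfolding B(3) k by (simp add: emeasure_distr vimage_def)
  let ?D = "closure V - ?W"
  note null = hull_lebesgue_convex(2)[OF V(1) bdV]
  have "E \<subseteq> E' \<union> ?D"
    using E sub by (auto simp: E'_def)
  then have "emeasure (hull_lebesgue V) E \<le> emeasure (hull_lebesgue V) (E' \<union> ?D)"
    by (rule emeasure_mono)
      (simp add: hull_lebesgue_def sets\<mu> borel_closed rel_interior_borel sets.Un sets.Diff)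
  also have "\<dots> = emeasure ?\<mu> (E' \<union> ?D)"
    by (simp add: hull_lebesgue_def sets\<mu> borel_closed rel_interior_borel sets.Un sets.Diff)
  also have "\<dots> = emeasure ?\<mu> E'"
    by (rule emeasure_Un_null_set[OF _ null]) (simp add: sets\<mu>)
  also note main
  also have "emeasure ?\<mu> ?W = emeasure (hull_lebesgue V) ?W"
    by (simp add: hull_lebesgue_def sets\<mu> rel_interior_borel)
  also have "\<dots> \<le> emeasure (hull_lebesgue V) V"
    using sub hull_lebesgue_convex(1)[OF V(1) bdV] by (intro emeasure_mono) auto
  also have "\<dots> = ennreal (measure (hull_lebesgue V) V)"
    using hull_lebesgue_convex(1)[OF V(1) bdV] by (intro emeasure_eq_measure2) auto
  finally have "emeasure (hull_lebesgue V) E \<le> ennreal (real k * c * measure (hull_lebesgue V) V)"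
    using c by (simp add: ennreal_mult mult_left_mono)
  then have "measure (hull_lebesgue V) E \<le> real k * c * measure (hull_lebesgue V) V"
    using c unfolding measure_def by (intro enn2real_leI) auto
  then show ?thesis
    by (simp add: c_def mult_ac)
qed (use \<tau> in \<open>simp add: measure_notin_sets\<close>)

section \<open>The volume bound\<close>

text \<open>Complex linearity of the total derivative, restricted to the second factor, makes it
  multiplication by \<open>F (0, 1)\<close>.\<close>

lemma holomorphic_family_section:
  assumes "holomorphic_family f U D" "v \<in> U" "z \<in> D"
  shows "f v field_differentiable (at z)"
proof -
  obtain F where F: "((\<lambda>(v, z). f v z) has_derivative F) (at (v, z))"
    "\<And>c w y. F (c *s w, c * y) = c * F (w, y)"
    using assms unfolding holomorphic_family_def by blast
  have "((\<lambda>y. (v, y)) has_derivative (\<lambda>y. (0, y))) (at z)"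
    by (intro derivative_eq_intros) auto
  from has_derivative_compose[OF this F(1)]
  have "(f v has_derivative (\<lambda>y. F (0, y))) (at z)"
    by simp
  also have "(\<lambda>y. F (0, y)) = (*) (F (0, 1))"
  proof
    show "F (0, y) = F (0, 1) * y" for y
      using F(2)[of y 0 1] by (simp add: mult.commute)
  qed
  finally have "(f v has_field_derivative F (0, 1)) (at z)"
    unfolding has_field_derivative_def .
  then show ?thesis
    by (auto simp: field_differentiable_def)
qed

lemma holomorphic_family_continuous:
  assumes "holomorphic_family f U D" "z \<in> D"
  shows "continuous_on U (\<lambda>v. f v z)"
proof (rule continuous_at_imp_continuous_on, rule)
  fix v assume "v \<in> U"
  then obtain F where "((\<lambda>(v, z). f v z) has_derivative F) (at (v, z))"
    using assms unfolding holomorphic_family_def by blast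
  then have "isCont (\<lambda>(v, z). f v z) (v, z)"
    by (rule has_derivative_continuous)
  then show "isCont (\<lambda>v. f v z) v"
    using isCont_o2[of v "\<lambda>v. (v, z)" "\<lambda>(v, z). f v z"] by simp
qed

lemma powr_sublevel_eq:
  fixes M1 M2 \<rho> T \<delta> :: real
  assumes "M1 > 0" "M2 > 0" "\<rho> > 0"
  shows "(M1 * \<rho> powr T / M2) powr (1 / \<delta>) = (M1 / M2) powr (1 / \<delta>) * exp (- (ln (1 / \<rho>) / \<delta>) * T)"
proof -
  have "(M1 * \<rho> powr T / M2) powr (1 / \<delta>) = (M1 / M2) powr (1 / \<delta>) * (\<rho> powr T) powr (1 / \<delta>)"
    using assms by (subst powr_mult[symmetric]) auto
  also have "(\<rho> powr T) powr (1 / \<delta>) = exp (- (ln (1 / \<rho>) / \<delta>) * T)"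
    using assms by (simp add: powr_powr powr_def ln_div)
  finally show ?thesis .
qed

text \<open>The convention \<open>1 / 0 = 0\<close> makes the first bound collapse to
  \<open>4 * k\<close> times the volume of \<open>V\<close> when the degree is 0. There the intended
  exponent \<open>1 / d\<close> is infinite, so the second conjunct asserts the bound for every
  positive \<delta> instead.\<close>

theorem theorem1p5:
  fixes f :: "complex^'s \<Rightarrow> complex \<Rightarrow> complex"
    and V :: "(complex^'s) set"
    and R M1 M2 \<rho> T :: real and k :: nat
  assumes "R > 1"
    and "holomorphic_family f (ball 0 R) (ball 0 1)"
    and "V \<subseteq> ball 0 1" and "convex V"
    and "aff_dim V = int k" and "k \<ge> 1"
    and "(SUP v\<in>V. SUP z\<in>ball 0 1. ereal (norm (f v z))) \<le> ereal M1"
    and "(SUP v\<in>V. ereal (norm (f v 0))) \<ge> ereal M2" and "M2 > 0"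
    and "0 < \<rho>" and "\<rho> < 1" and "T \<ge> 0"
  shows "let d = chebyshev_degree (\<lambda>v. f v 0);
             vol = measure (hull_lebesgue V);
             bound = (\<lambda>\<delta>::real. 4 * real k * (M1 / M2) powr (1 / \<delta>)
                        * exp (- (ln (1 / \<rho>) / \<delta>) * T) * vol V)
         in vol {v \<in> V. zero_count f \<rho> v \<ge> ereal T} \<le> bound (real_of_ereal d)
            \<and> (d = 0 \<longrightarrow> (\<forall>\<delta>>0. vol {v \<in> V. zero_count f \<rho> v \<ge> ereal T} \<le> bound \<delta>))"
proof -
  define h where "h v = f v 0" for v
  define vol where "vol = measure (hull_lebesgue V)"
  define E where "E = {v \<in> V. zero_count f \<rho> v \<ge> ereal T}"
  define \<tau> where "\<tau> = M1 * \<rho> powr T"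
  have bdV: "bounded V" "V \<noteq> {}"
    using assms(3,5,6) by (auto intro: bounded_subset[OF bounded_ball])
  have sub: "ball 0 1 \<subseteq> (ball 0 R :: (complex^'s) set)"
    using assms(1) by auto
  have M1: "norm (f v z) \<le> M1" if "v \<in> V" "z \<in> ball 0 1" for v z
  proof -
    have "ereal (norm (f v z)) \<le> (SUP z\<in>ball 0 1. ereal (norm (f v z)))"
      using that(2) by (rule SUP_upper)
    also have "\<dots> \<le> (SUP v\<in>V. SUP z\<in>ball 0 1. ereal (norm (f v z)))"
      using that(1) by (rule SUP_upper)
    also note assms(7)
    finally show ?thesis by simp
  qed
  have "(SUP v\<in>V. ereal (norm (f v 0))) \<le> ereal M1"
    using M1 by (intro SUP_least) auto
  then have "ereal M2 \<le> ereal M1"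
    by (rule order_trans[OF assms(8)])
  then have M1pos: "M1 > 0"
    using assms(9) by simp
  then have \<tau>: "\<tau> > 0"
    using assms(10) by (simp add: \<tau>_def)
  have "norm (h v) \<le> \<tau>" if v: "v \<in> E" for v
    unfolding h_def \<tau>_def
  proof (rule norm_at_0_le_powr_zero_count[where f = f and M = M1 and \<rho> = \<rho>])
    have vV: "v \<in> V" and "v \<in> ball 0 R"
      using v sub assms(3) by (auto simp: E_def)
    then show "f v holomorphic_on ball 0 1"
      unfolding holomorphic_on_def
      by (metis field_differentiable_at_within holomorphic_family_section[OF assms(2)])
    show "norm (f v z) \<le> M1" if "z \<in> ball 0 1" for z
      using vV that by (rule M1)
    show "ereal T \<le> zero_count f \<rho> v"
      using v by (simp add: E_def)
  qed (use assms in auto)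
  then have Esub: "E \<subseteq> {v \<in> V. norm (h v) \<le> \<tau>}"
    by (auto simp: E_def)
  have conth: "continuous_on (ball 0 1) h"
    unfolding h_def using holomorphic_family_continuous[OF assms(2), of 0] sub
    by (auto intro: continuous_on_subset)
  \<comment> \<open>The supremum may be unattained, or approached only at the relative boundary. The
    set where \<open>norm (h v)\<close> exceeds \<open>m\<close> is open and meets \<open>V\<close>,
    so it meets the relative interior, which is dense in \<open>V\<close>.\<close>
  have near: "\<exists>v0 \<in> rel_interior V. m < norm (h v0)" if m: "m < M2" for m
  proof -
    have "ereal m < (SUP v\<in>V. ereal (norm (f v 0)))"
      using m by (intro less_le_trans[OF _ assms(8)]) simp
    then obtain v where v: "v \<in> V" "m < norm (h v)"
      by (auto simp: less_SUP_iff h_def)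
    have "open (ball 0 1 \<inter> (\<lambda>v. norm (h v)) -` {m<..})"
      by (intro continuous_open_preimage continuous_on_norm conth) auto
    moreover have "v \<in> closure (rel_interior V)"
      using v(1) convex_closure_rel_interior[OF assms(4)] closure_subset by auto
    ultimately have "(ball 0 1 \<inter> (\<lambda>v. norm (h v)) -` {m<..}) \<inter> rel_interior V \<noteq> {}"
      using v assms(3) by (subst open_Int_closure_eq_empty[symmetric]) auto
    then show ?thesis by auto
  qed
  have bound: "vol E \<le> 4 * real k * (\<tau> / M2) powr (1 / \<delta>) * vol V"
    if \<delta>: "\<delta> > 0" "chebyshev_degree h < ereal \<delta>" for \<delta>
  proof -
    \<comment> \<open>Strict inequality provides an admissible constant below
      \<open>\<delta>\<close> whether or not the infimum is attained.\<close>
    obtain d where d: "chebyshev_constant h d" "d \<le> \<delta>"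
      using \<delta>(2) by (auto simp: chebyshev_degree_def Inf_less_iff)
    have le: "vol E \<le> 4 * real k * (\<tau> / m) powr (1 / \<delta>) * vol V" if m: "0 < m" "m < M2" for m
    proof -
      obtain v0 where v0: "v0 \<in> rel_interior V" "m < norm (h v0)"
        using near[OF m(2)] by blast
      have pos: "0 < norm (h v0)"
        using v0(2) m(1) by linarith
      have "vol E \<le> 4 * real k * (\<tau> / norm (h v0)) powr (1 / \<delta>) * vol V"
        unfolding vol_def using v0 m
        by (intro sublevel_measure_le[OF d \<delta>(1) assms(4,3,5,6) conth _ _ \<tau> Esub]) auto
      also have "\<dots> \<le> 4 * real k * (\<tau> / m) powr (1 / \<delta>) * vol V"
        using v0 m \<tau> \<delta>(1) pos mult_pos_pos[OF pos m(1)] unfolding vol_def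
        by (intro mult_right_mono mult_left_mono powr_mono2 divide_left_mono) auto
      finally show ?thesis .
    qed
    have lim: "((\<lambda>m. 4 * real k * (\<tau> / m) powr (1 / \<delta>) * vol V)
        \<longlongrightarrow> 4 * real k * (\<tau> / M2) powr (1 / \<delta>) * vol V) (at_left M2)"
      using assms(9) \<tau> by (intro tendsto_intros) auto
    have "eventually (\<lambda>m. m \<in> {0<..<M2}) (at_left M2)"
      using assms(9) by (intro eventually_at_leftI[of 0]) auto
    then have "eventually (\<lambda>m. vol E \<le> 4 * real k * (\<tau> / m) powr (1 / \<delta>) * vol V) (at_left M2)"
      by (rule eventually_mono) (use le in auto)
    then show ?thesis
      using lim by (intro tendsto_lowerbound) auto
  qed
  have trivial: "vol E \<le> 4 * real k * vol V"
  proof -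
    have "vol E \<le> 1 * vol V"
      unfolding vol_def by (simp, intro measure_hull_lebesgue_le_convex assms(4) bdV) (auto simp: E_def)
    also have "\<dots> \<le> 4 * real k * vol V"
      using assms(6) by (intro mult_right_mono) (auto simp: vol_def)
    finally show ?thesis .
  qed
  let ?d = "chebyshev_degree h"
  have d0: "0 \<le> ?d"
    unfolding chebyshev_degree_def by (rule Inf_greatest) auto
  have "vol E \<le> 4 * real k * (\<tau> / M2) powr (1 / real_of_ereal ?d) * vol V"
  \<comment> \<open>The value 0 stands for degree 0 and, through \<open>real_of_ereal\<close>, for
    degree \<infinity>; in both cases the power is 1 and the trivial bound suffices.\<close>
  proof (cases "real_of_ereal ?d = 0")
    case True
    then show ?thesis
      using trivial \<tau> assms(9) by simp
  next
    case False
    then obtain d where d: "?d = ereal d" "d > 0"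
      using d0 by (cases ?d) auto
    have lim: "((\<lambda>\<delta>. 4 * real k * (\<tau> / M2) powr (1 / \<delta>) * vol V)
        \<longlongrightarrow> 4 * real k * (\<tau> / M2) powr (1 / d) * vol V) (at_right d)"
      using d assms(9) \<tau> by (intro tendsto_intros) auto
    have "eventually (\<lambda>\<delta>. vol E \<le> 4 * real k * (\<tau> / M2) powr (1 / \<delta>) * vol V) (at_right d)"
      using eventually_at_right_less[of d]
      by (rule eventually_mono) (use bound d in auto)
    then have "vol E \<le> 4 * real k * (\<tau> / M2) powr (1 / d) * vol V"
      using lim by (intro tendsto_lowerbound) auto
    then show ?thesis
      by (simp add: d)
  qed
  moreover have "vol E \<le> 4 * real k * (\<tau> / M2) powr (1 / \<delta>) * vol V" if "?d = 0" "\<delta> > 0" for \<delta>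
    using bound[of \<delta>] that by simp
  ultimately show ?thesis
    unfolding Let_def powr_sublevel_eq[OF M1pos assms(9,10), of T, folded \<tau>_def] h_def vol_def E_def
    by (simp add: mult.assoc)
qed

end
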